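(* Let $m,p\in\mathbb N$ and $\omega>0$. Let $A,B\in\mathbb R^{m\times m}$ be constant matrices, let $f:\mathbb R\times\mathbb R^m\to\mathbb R^m$ and $h:\mathbb R^m\to\mathbb R^m$ be continuous, with $f(t+\omega,x)=f(t,x)$ for all $t\in\mathbb R$, $x\in\mathbb R^m$. Let $\{\theta_k\}_{k\in\mathbb Z}$ be a strictly increasing sequence of reals with $\theta_{k+p}=\theta_k+\omega$ for all $k\in\mathbb Z$. Let $\{\sigma_k\}_{k\in\mathbb Z}$ be a bounded sequence in $\mathbb R^m$, $\sup_k\|\sigma_k\|\le M_\sigma$ with $M_\sigma>0$, and define $g:\mathbb R\to\mathbb R^m$ by $g(t)=\sigma_k$ for $t\in(\theta_{kp},\theta_{(k+1)p}]$, $k\in\mathbb Z$. Consider the impulsive system $$\frac{dx}{dt}=Ax+f(t,x)+g(t),\ t\neq\theta_k,\qquad \Delta x|_{t=\theta_k}=Bx(\theta_k)+h(x(\theta_k)),$$ where $\Delta x|_{t=\theta_k}=x(\theta_k+)-x(\theta_k)$. Assume: (A1) $AB=BA$ and $\det(I+B)\neq0$; (A2) all eigenvalues of $A+\frac{p}{\omega}\log(I+B)$ have negative real parts; (A3) there are $M_f,M_h>0$ with $\sup_{t,x}\|f(t,x)\|\le M_f$ and $\sup_x\|h(x)\|\le M_h$; (A4) there are $L_f,L_h>0$ with $\|f(t,x_1)-f(t,x_2)\|\le L_f\|x_1-x_2\|$ for all $t,x_1,x_2$ and $\|h(x_1)-h(x_2)\|\le L_h\|x_1-x_2\|$ for all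 $x_1,x_2$; and let $N,\lambda>0$ be constants such that the matriciant $U(t,s)=e^{A(t-s)}(I+B)^{i([s,t))}$ ($t>s$), $U(s,s)=I$, of the linear system $x'=Ax$, $\Delta x|_{t=\theta_k}=Bx(\theta_k)$ satisfies $\|U(t,s)\|\le Ne^{-\lambda(t-s)}$ for all $t\ge s$, and assume moreover (A5) $N\left(\frac{L_f}{\lambda}+\frac{pL_h}{1-e^{-\lambda\omega}}\right)<1$; (A6) $NL_f+\frac{p}{\omega}\ln(1+NL_h)<\lambda$; (A7) $L_h\|(I+B)^{-1}\|<1$. If the sequence $\{\sigma_k\}_{k\in\mathbb Z}$ is unpredictable, then the impulsive system possesses a unique asymptotically stable unpredictable solution.
   Context: Norms are the Euclidean norm on vectors and the spectral norm on matrices. $i(J)$ denotes the number of terms of $\{\theta_k\}$ in the interval $J$. Solutions of the impulsive system are piecewise continuous functions, continuous except possibly at the $\theta_k$, left continuous at each $\theta_k$ with right limits $x(\theta_k+)$, satisfying the differential equation between impulse moments and the jump condition at each $\theta_k$. A bounded sequence $\{\sigma_k\}_{k\in\mathbb Z}$ is unpredictable if there exist $\delta_0>0$ and sequences $\{\zeta_n\}_{n\in\mathbb N}$, $\{\eta_n\}_{n\in\mathbb N}$ of positive integers, both diverging to infinity, such that $\|\sigma_{k+\zeta_n}-\sigma_k\|\to0$ as $n\to\infty$ for each $k$ in bounded intervals of integers, and $\|\sigma_{\zeta_n+\eta_n}-\sigma_{\eta_n}\|\ge\delta_0$ for each $n$. Given a strictly increasing sequence $\{\theta_k\}$ with $\theta_{k+p}=\theta_k+\omega$,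 a piecewise continuous bounded function $\varphi:\mathbb R\to\mathbb R^m$ whose set of possible discontinuity points is $\{\theta_k\}$ and with $\lim_{t\to\theta_k^-}\varphi(t)=\varphi(\theta_k)$ for all $k$ is called unpredictable if there exist $\epsilon_0>0$, $r>0$ and sequences of reals $\{\mu_n\}$, $\{\tau_n\}$, both diverging to infinity, such that: (i) for every $\epsilon>0$ there is $\delta>0$ with $\|\varphi(s_1)-\varphi(s_2)\|<\epsilon$ whenever $s_1,s_2$ lie in the same interval of continuity and $|s_1-s_2|<\delta$; (ii) $\|\varphi(t+\mu_n)-\varphi(t)\|\to0$ as $n\to\infty$ uniformly on compact subsets of $\mathbb R$; (iii) $\|\varphi(t+\mu_n)-\varphi(t)\|\ge\epsilon_0$ for each $t\in[\tau_n-r,\tau_n+r]$ and $n\in\mathbb N$. *)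

theory Defs
  imports "HOL-Analysis.Analysis"
begin

primrec mpow :: "('a::semiring_1)^'n^'n \<Rightarrow> nat \<Rightarrow> 'a^'n^'n" where
  "mpow M 0 = mat 1"
| "mpow M (Suc k) = M ** mpow M k"

definition mexp :: "('a::{real_normed_field,banach})^'n^'n \<Rightarrow> 'a^'n^'n" where
  "mexp M = (\<Sum>k. inverse (fact k) *\<^sub>R mpow M k)"

definition mnorm :: "real^'n^'m \<Rightarrow> real" where
  "mnorm M = onorm (\<lambda>x. M *v x)"

definition cmat :: "real^'n^'m \<Rightarrow> complex^'n^'m" where
  "cmat M = (\<chi> i j. complex_of_real (M $ i $ j))"

definition is_eigenvalue :: "complex^'n^'n \<Rightarrow> complex \<Rightarrow> bool" where
  "is_eigenvalue M c \<longleftrightarrow> (\<exists>v. v \<noteq> 0 \<and> M *v v = c *s v)"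

definition icount :: "(int \<Rightarrow> real) \<Rightarrow> real \<Rightarrow> real \<Rightarrow> nat" where
  "icount \<theta> s t = card {k. s \<le> \<theta> k \<and> \<theta> k < t}"

text \<open>Matriciant of x' = Ax, Delta x = Bx at theta_k (for t \<ge> s; U(s,s) = I).\<close>
definition matriciant :: "(int \<Rightarrow> real) \<Rightarrow> real^'n^'n \<Rightarrow> real^'n^'n \<Rightarrow> real \<Rightarrow> real \<Rightarrow> real^'n^'n" where
  "matriciant \<theta> A B t s =
     (if t = s then mat 1 else mexp ((t - s) *\<^sub>R A) ** mpow (mat 1 + B) (icount \<theta> s t))"

definition imp_solution ::
  "(int \<Rightarrow> real) \<Rightarrow> (real \<Rightarrow> 'a::real_normed_vector \<Rightarrow> 'a) \<Rightarrow> ('a \<Rightarrow> 'a) \<Rightarrow> (real \<Rightarrow> 'a) \<Rightarrow> bool" where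
  "imp_solution \<theta> F J x \<longleftrightarrow>
     (\<forall>t. t \<notin> range \<theta> \<longrightarrow> (x has_vector_derivative F t (x t)) (at t)) \<and>
     (\<forall>k. continuous (at_left (\<theta> k)) x) \<and>
     (\<forall>k. (x \<longlongrightarrow> x (\<theta> k) + J (x (\<theta> k))) (at_right (\<theta> k)))"

definition imp_solution_from ::
  "(int \<Rightarrow> real) \<Rightarrow> (real \<Rightarrow> 'a::real_normed_vector \<Rightarrow> 'a) \<Rightarrow> ('a \<Rightarrow> 'a) \<Rightarrow> real \<Rightarrow> (real \<Rightarrow> 'a) \<Rightarrow> bool" where
  "imp_solution_from \<theta> F J t0 x \<longleftrightarrow>
     (\<forall>t. t0 < t \<and> t \<notin> range \<theta> \<longrightarrow> (x has_vector_derivative F t (x t)) (at t)) \<and>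
     (t0 \<notin> range \<theta> \<longrightarrow> continuous (at_right t0) x) \<and>
     (\<forall>k. t0 < \<theta> k \<longrightarrow> continuous (at_left (\<theta> k)) x) \<and>
     (\<forall>k. t0 \<le> \<theta> k \<longrightarrow> (x \<longlongrightarrow> x (\<theta> k) + J (x (\<theta> k))) (at_right (\<theta> k)))"

definition imp_asym_stable ::
  "(int \<Rightarrow> real) \<Rightarrow> (real \<Rightarrow> 'a::real_normed_vector \<Rightarrow> 'a) \<Rightarrow> ('a \<Rightarrow> 'a) \<Rightarrow> (real \<Rightarrow> 'a) \<Rightarrow> bool" where
  "imp_asym_stable \<theta> F J x \<longleftrightarrow>
     (\<forall>t0. \<forall>\<epsilon>>0. \<exists>\<delta>>0. \<forall>y. imp_solution_from \<theta> F J t0 y \<and> norm (y t0 - x t0) < \<delta> \<longrightarrow>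
          (\<forall>t\<ge>t0. norm (y t - x t) < \<epsilon>)) \<and>
     (\<forall>t0. \<exists>\<delta>0>0. \<forall>y. imp_solution_from \<theta> F J t0 y \<and> norm (y t0 - x t0) < \<delta>0 \<longrightarrow>
          ((\<lambda>t. norm (y t - x t)) \<longlongrightarrow> 0) at_top)"

definition unpredictable_seq :: "(int \<Rightarrow> 'a::real_normed_vector) \<Rightarrow> bool" where
  "unpredictable_seq \<sigma> \<longleftrightarrow> bounded (range \<sigma>) \<and>
     (\<exists>\<delta>0>0. \<exists>\<zeta> \<eta> :: nat \<Rightarrow> nat.
        (\<forall>n. \<zeta> n > 0 \<and> \<eta> n > 0) \<and>
        filterlim \<zeta> at_top sequentially \<and> filterlim \<eta> at_top sequentially \<and>
        (\<forall>k. (\<lambda>n. \<sigma> (k + int (\<zeta> n))) \<longlonglongrightarrow> \<sigma> k) \<and>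
        (\<forall>n. norm (\<sigma> (int (\<zeta> n) + int (\<eta> n)) - \<sigma> (int (\<eta> n))) \<ge> \<delta>0))"

definition unpredictable_fun :: "(int \<Rightarrow> real) \<Rightarrow> (real \<Rightarrow> 'a::real_normed_vector) \<Rightarrow> bool" where
  "unpredictable_fun \<theta> \<phi> \<longleftrightarrow>
     bounded (range \<phi>) \<and>
     (\<forall>t. t \<notin> range \<theta> \<longrightarrow> isCont \<phi> t) \<and>
     (\<forall>k. continuous (at_left (\<theta> k)) \<phi>) \<and>
     (\<forall>\<epsilon>>0. \<exists>\<delta>>0. \<forall>k s1 s2. s1 \<in> {\<theta> k<..\<theta> (k+1)} \<and> s2 \<in> {\<theta> k<..\<theta> (k+1)} \<and>
         \<bar>s1 - s2\<bar> < \<delta> \<longrightarrow> norm (\<phi> s1 - \<phi> s2) < \<epsilon>) \<and>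
     (\<exists>\<epsilon>0>0. \<exists>r>0. \<exists>\<mu> \<tau> :: nat \<Rightarrow> real.
        filterlim \<mu> at_top sequentially \<and> filterlim \<tau> at_top sequentially \<and>
        (\<forall>K. compact K \<longrightarrow> uniform_limit K (\<lambda>n t. \<phi> (t + \<mu> n)) \<phi> sequentially) \<and>
        (\<forall>n. \<forall>t\<in>{\<tau> n - r..\<tau> n + r}. norm (\<phi> (t + \<mu> n) - \<phi> t) \<ge> \<epsilon>0))"

end

theory Submission
  imports Defs "HOL-Real_Asymp.Real_Asymp"
begin

text \<open>Variation of constants for the matriciant and an impulsive Gronwall inequality show that, by (A6),
  any two solutions approach each other like \<open>exp (- \<kappa> t)\<close> with
  \<open>\<kappa> = lam - N L\<^sub>f - (p/\<omega>) ln (1 + N L\<^sub>h) > 0\<close>. Hence the solutions that start from \<open>0\<close> in the ever more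
  remote past converge to a bounded solution on the whole line, which is asymptotically stable and the
  only bounded one. Shifting time by \<open>\<zeta>\<^sub>n \<omega>\<close> shifts \<open>\<sigma>\<close> by \<open>\<zeta>\<^sub>n\<close> and leaves \<open>f\<close> and \<open>\<theta>\<close> unchanged,
  so the same estimate with forcing terms close on a long window gives \<open>x(t + \<zeta>\<^sub>n \<omega>) \<rightarrow> x(t)\<close> locally
  uniformly. On the period with index \<open>\<eta>\<^sub>n\<close> the two forcing terms differ by a constant vector of norm at
  least \<open>\<delta>\<^sub>0\<close>, which drives \<open>x(t + \<zeta>\<^sub>n \<omega>)\<close> and \<open>x(t)\<close> apart; the Lipschitz bound spreads this over an
  interval of fixed length.\<close>

subsection \<open>The matrix exponential\<close>

text \<open>As a function of the initial time \<open>r\<close>, the matriciant \<open>U(t,r)\<close>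
  jumps at the impulse moments, and so do solutions. Between two moments the number of impulses is
  therefore frozen, which leaves a smooth matrix function. At a moment, the factor
  \<open>I + B\<close> of the matriciant absorbs the linear part of the jump, so that only its
  nonlinear part has to be estimated. Perturbations are then controlled by comparing derivatives gap
  by gap. One Gronwall bound with the weight \<open>norm u + e\<close> serves every purpose:
  \<open>e = 0\<close> gives contraction, \<open>e = E0\<close> turns the bounded nonlinear terms
  into a bound on solutions, and a small \<open>e\<close> measures how far two forcing terms differ.
  The \<open>e\<close> part carries a factor \<open>exp (lam * (T - s))\<close>. This is harmless
  because the window from \<open>s\<close> to \<open>T\<close> either is one period long or is fixed
  before \<open>e\<close> is chosen. Solutions are constructed only forward in time. They are
  encoded by their values at the \<theta>_k, so the passage to the remote past is a limit of vectors
  that obey a recursion, not a limit of discontinuous functions.\<close>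

lemma bounded_bilinear_matrix_vector_mult:
  "bounded_bilinear ((*v) :: real^'n^'m \<Rightarrow> real^'n \<Rightarrow> real^'m)"
  unfolding bilinear_conv_bounded_bilinear[symmetric] bilinear_def
  by (auto intro!: linearI simp: matrix_vector_right_distrib matrix_vector_mult_add_rdistrib
      matrix_vector_mult_scaleR scaleR_matrix_vector_assoc)

lemma bounded_bilinear_matrix_matrix_mult:
  "bounded_bilinear ((**) :: real^'n^'m \<Rightarrow> real^'k^'n \<Rightarrow> real^'k^'m)"
  unfolding bilinear_conv_bounded_bilinear[symmetric] bilinear_def
  by (auto intro!: linearI simp: matrix_matrix_mult_def vec_eq_iff sum.distrib algebra_simps
      scaleR_sum_right sum_distrib_left)

lemma norm_matrix_vector_mult_le: "norm (M *v x) \<le> mnorm M * norm x"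
  unfolding mnorm_def by (rule onorm) simp

lemma mnorm_nonneg: "0 \<le> mnorm M"
  unfolding mnorm_def by (rule onorm_pos_le) simp

lemma mpow_Suc_right: "mpow M (Suc k) = mpow M k ** M"
  by (induction k) (auto simp: matrix_mul_assoc)

lemma mpow_commute: "A ** M = M ** A \<Longrightarrow> A ** mpow M k = mpow M k ** A"
proof (induction k)
  case (Suc k)
  then show ?case
    by (metis matrix_mul_assoc mpow.simps(2))
qed simp

lemma mpow_scaleR: "mpow (t *\<^sub>R M) k = t ^ k *\<^sub>R mpow (M :: real^'n^'n) k"
proof (induction k)
  case (Suc k)
  interpret bounded_bilinear "(**) :: real^'n^'n \<Rightarrow> real^'n^'n \<Rightarrow> _"
    by (rule bounded_bilinear_matrix_matrix_mult)
  show ?case by (simp add: Suc scaleR_left scaleR_right)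
qed simp

text \<open>Comparison with a scalar exponential series. The constant \<open>K\<close> of bounded
  bilinearity takes the place of submultiplicativity of the norm on the matrix type.\<close>

lemma mexp_summable: "summable (\<lambda>k. inverse (fact k) *\<^sub>R mpow (M :: real^'n^'n) k)"
proof -
  obtain K where K: "K > 0" "\<And>(X :: real^'n^'n) (Y :: real^'n^'n). norm (X ** Y) \<le> norm X * norm Y * K"
    using bounded_bilinear.pos_bounded[OF bounded_bilinear_matrix_matrix_mult] by metis
  have bound: "norm (mpow M k) \<le> norm (mat 1 :: real^'n^'n) * (norm M * K) ^ k" for k
  proof (induction k)
    case (Suc k)
    have "norm (mpow M (Suc k)) \<le> norm M * norm (mpow M k) * K"
      using K(2)[of M "mpow M k"] by simp
    also have "\<dots> \<le> norm M * (norm (mat 1 :: real^'n^'n) * (norm M * K) ^ k) * K"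
      using Suc K(1) by (intro mult_right_mono mult_left_mono) auto
    finally show ?case by (simp add: algebra_simps)
  qed simp
  show ?thesis
  proof (rule summable_comparison_test')
    show "summable (\<lambda>k. norm (mat 1 :: real^'n^'n) * (inverse (fact k) * (norm M * K) ^ k))"
      by (intro summable_mult summable_exp)
    show "norm (inverse (fact k) *\<^sub>R mpow M k)
        \<le> norm (mat 1 :: real^'n^'n) * (inverse (fact k) * (norm M * K) ^ k)" for k
      using mult_left_mono[OF bound, of "inverse (fact k)" k] by (simp add: algebra_simps)
  qed
qed

lemma mexp_zero [simp]: "mexp (0 :: real^'n^'n) = mat 1"
proof -
  have "mpow (0 :: real^'n^'n) k = (if k = 0 then mat 1 else 0)" for k
    by (cases k) (auto simp: matrix_matrix_mult_def vec_eq_iff)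
  then have "mexp (0 :: real^'n^'n) = (\<Sum>k. if k = 0 then mat 1 else 0)"
    unfolding mexp_def by (intro suminf_cong) auto
  also have "\<dots> = mat 1"
    using sums_single[of 0 "\<lambda>_. mat 1 :: real^'n^'n"] by (simp add: sums_iff)
  finally show ?thesis .
qed

text \<open>Each entry is a real power series in \<open>t\<close>, so it may be differentiated
  termwise. The coefficients \<open>diffs c\<close> contain \<open>mpow M (Suc k) / fact k\<close>,
  and splitting off the last factor \<open>M\<close> leaves the exponential series again.\<close>

lemma mexp_scaleR_has_vector_derivative:
  fixes M :: "real^'n^'n"
  shows "((\<lambda>t. mexp (t *\<^sub>R M)) has_vector_derivative mexp (t *\<^sub>R M) ** M) (at t)"
proof -
  have comp: "((\<lambda>t. mexp (t *\<^sub>R M) $ i $ j) has_vector_derivative (mexp (t *\<^sub>R M) ** M) $ i $ j) (at t)"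
    for i j
  proof -
    define c where "c k = mpow M k $ i $ j / fact k" for k
    have lin: "bounded_linear (\<lambda>X :: real^'n^'n. X $ i $ j)"
      by (rule bounded_linear_compose[OF bounded_linear_vec_nth bounded_linear_vec_nth])
    have nth: "(\<lambda>k. (inverse (fact k) *\<^sub>R mpow (s *\<^sub>R M) k) $ i $ j) = (\<lambda>k. c k * s ^ k)" for s
      by (auto simp: c_def mpow_scaleR field_simps)
    have sums: "(\<lambda>k. c k * s ^ k) sums (mexp (s *\<^sub>R M) $ i $ j)" for s
      using bounded_linear.sums[OF lin summable_sums[OF mexp_summable[of "s *\<^sub>R M"]]]
      unfolding mexp_def nth by simp
    have lin': "bounded_linear (\<lambda>X :: real^'n^'n. (X ** M) $ i $ j)"
      using bounded_linear_compose[OF lin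
          bounded_bilinear.bounded_linear_left[OF bounded_bilinear_matrix_matrix_mult]] .
    have "(\<lambda>k. (inverse (fact k) *\<^sub>R mpow (t *\<^sub>R M) k ** M) $ i $ j) = (\<lambda>k. diffs c k * t ^ k)"
    proof
      fix k
      interpret bounded_bilinear "(**) :: real^'n^'n \<Rightarrow> real^'n^'n \<Rightarrow> _"
        by (rule bounded_bilinear_matrix_matrix_mult)
      show "(inverse (fact k) *\<^sub>R mpow (t *\<^sub>R M) k ** M) $ i $ j = diffs c k * t ^ k"
        by (simp add: mpow_scaleR scaleR_left mpow_Suc_right[symmetric] diffs_def c_def
            field_simps del: mpow.simps of_nat_Suc)
    qed
    then have "(\<lambda>k. diffs c k * t ^ k) sums ((mexp (t *\<^sub>R M) ** M) $ i $ j)"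
      using bounded_linear.sums[OF lin' summable_sums[OF mexp_summable[of "t *\<^sub>R M"]]]
      unfolding mexp_def by simp
    then have "((\<lambda>s. \<Sum>k. c k * s ^ k) has_field_derivative (mexp (t *\<^sub>R M) ** M) $ i $ j) (at t)"
      using termdiffs_strong_converges_everywhere[of c t] sums by (auto simp: sums_iff)
    then show ?thesis
      using sums by (simp add: sums_iff has_real_derivative_iff_has_vector_derivative)
  qed
  show ?thesis
    unfolding has_vector_derivative_def
    by (subst has_derivative_componentwise_within)
       (auto simp: Basis_vec_def inner_axis' inner_axis comp[unfolded has_vector_derivative_def real_scaleR_def])
qed


subsection \<open>One-sided limits and local boundedness\<close>

text \<open>Solutions jump, so boundedness on a compact interval cannot come from continuity.
  One-sided limits give it near each point, and bisection makes it global.\<close>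

lemma bounded_image_if_locally_bounded:
  fixes u :: "real \<Rightarrow> 'a::metric_space"
  assumes "a \<le> b"
    and loc: "\<And>x. a \<le> x \<Longrightarrow> x \<le> b \<Longrightarrow> \<exists>d>0. bounded (u ` ({x - d<..<x + d} \<inter> {a..b}))"
  shows "bounded (u ` {a..b})"
proof -
  \<comment> \<open>The bisection varies the interval, while \<open>S\<close> keeps the original one
    fixed, so that local bounds are asked for only inside it.\<close>
  define S where "S = {a..b}"
  have "bounded (u ` ({a..b} \<inter> S))"
    using \<open>a \<le> b\<close>
  proof (induction rule: Bolzano)
    case (trans x y z)
    then have "{x..z} \<inter> S = ({x..y} \<inter> S) \<union> ({y..z} \<inter> S)"
      by auto
    then show ?case
      using trans by (simp only: image_Un bounded_Un)
  next
    case (local x)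
    then obtain d where "d > 0" and d: "bounded (u ` ({x - d<..<x + d} \<inter> S))"
      using loc unfolding S_def by blast
    have "bounded (u ` ({y..z} \<inter> S))" if "y \<le> x" "x \<le> z" "z - y < d" for y z
      using that by (intro bounded_subset[OF d] image_mono) auto
    with \<open>d > 0\<close> show ?case
      by blast
  qed
  then show ?thesis by (simp add: S_def)
qed

lemma tendsto_at_right_bounded_near:
  fixes u :: "real \<Rightarrow> 'a::metric_space"
  assumes "(u \<longlongrightarrow> l) (at_right x)"
  shows "\<exists>d>0. bounded (u ` {x<..<x + d})"
proof -
  obtain b where "b > x" and b: "\<And>y. y > x \<Longrightarrow> y < b \<Longrightarrow> dist (u y) l < 1"
    using tendstoD[OF assms, of 1] unfolding eventually_at_right_field by auto
  have "bounded (u ` {x<..<x + (b - x)})"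
    unfolding bounded_def using b by (auto intro!: exI[of _ l] exI[of _ 1] simp: dist_commute less_imp_le)
  with \<open>b > x\<close> show ?thesis by (intro exI[of _ "b - x"]) auto
qed

lemma tendsto_at_left_bounded_near:
  fixes u :: "real \<Rightarrow> 'a::metric_space"
  assumes "(u \<longlongrightarrow> l) (at_left x)"
  shows "\<exists>d>0. bounded (u ` {x - d<..<x})"
proof -
  obtain b where "b < x" and b: "\<And>y. y < x \<Longrightarrow> y > b \<Longrightarrow> dist (u y) l < 1"
    using tendstoD[OF assms, of 1] unfolding eventually_at_left_field by auto
  have "bounded (u ` {x - (x - b)<..<x})"
    unfolding bounded_def using b by (auto intro!: exI[of _ l] exI[of _ 1] simp: dist_commute less_imp_le)
  with \<open>b < x\<close> show ?thesis by (intro exI[of _ "x - b"]) auto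
qed

lemma filterlim_shift_at_left: "filterlim (\<lambda>t. t + d) (at_left (a + d)) (at_left (a :: real))"
  unfolding filterlim_at
  using eventually_at_left_real[of "a - 1" a]
  by (auto intro!: tendsto_eq_intros elim!: eventually_mono)

lemma filterlim_shift_at_right: "filterlim (\<lambda>t. t + d) (at_right (a + d)) (at_right (a :: real))"
  unfolding filterlim_at
  using eventually_at_right_less[of a]
  by (auto intro!: tendsto_eq_intros elim!: eventually_mono)

subsection \<open>Global solutions of Lipschitz differential equations\<close>

text \<open>The exponentially weighted supremum norm makes the Picard operator a contraction on the
  whole interval at once, so no short intervals have to be patched. The fixed point lives in the
  rescaled unknown \<open>x / W\<close>.\<close>

lemma picard_global:
  fixes F :: "real \<Rightarrow> 'a::banach \<Rightarrow> 'a"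
  assumes cont: "continuous_on UNIV (\<lambda>(t, x). F t x)"
    and lip: "\<And>t x y. norm (F t x - F t y) \<le> L * norm (x - y)"
    and "L > 0" "a \<le> b"
  shows "\<exists>x. x a = x0 \<and> (\<forall>t\<in>{a..b}. (x has_vector_derivative F t (x t)) (at t within {a..b}))"
proof -
  \<comment> \<open>The rate \<open>2 * L\<close> is chosen so that \<open>d * L * W\<close> has the
    primitive \<open>d / 2 * W\<close>, which yields the contraction factor 1/2.\<close>
  define W where "W t = exp (2 * L * (t - a))" for t
  \<comment> \<open>Clamping to \<open>{a..b}\<close> extends functions to the whole line, where the
    complete space of bounded continuous functions is available.\<close>
  define c where "c t = max a (min b t)" for t
  define G where "G \<phi> s = F s (W s *\<^sub>R apply_bcontfun \<phi> s)" for \<phi> :: "real \<Rightarrow>\<^sub>C 'a" and s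
  define Y where "Y \<phi> t = x0 + integral {a..t} (G \<phi>)" for \<phi> t
  have W_pos: "W t > 0" for t by (simp add: W_def)
  have c_in: "c t \<in> {a..b}" for t using \<open>a \<le> b\<close> by (auto simp: c_def)
  have c_cont: "continuous_on UNIV c"
    unfolding c_def by (intro continuous_intros)
  have W_cont: "continuous_on S W" for S
    unfolding W_def by (intro continuous_intros)
  have G_cont: "continuous_on S (G \<phi>)" for S \<phi>
  proof -
    have "continuous_on S (\<lambda>s. (s, W s *\<^sub>R apply_bcontfun \<phi> s))"
      by (intro continuous_intros W_cont) auto
    from continuous_on_compose2[OF cont this] show ?thesis
      by (auto simp: G_def)
  qed
  have Y_deriv: "(Y \<phi> has_vector_derivative G \<phi> t) (at t within {a..b})" if "t \<in> {a..b}" for \<phi> t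
    unfolding Y_def using integral_has_vector_derivative[OF G_cont that, of \<phi>]
    by (auto intro!: derivative_eq_intros)
  have Y_cont: "continuous_on {a..b} (Y \<phi>)" for \<phi>
    using has_vector_derivative_continuous[OF Y_deriv] by (auto simp: continuous_on_eq_continuous_within)
  have bc: "(\<lambda>t. inverse (W (c t)) *\<^sub>R Y \<phi> (c t)) \<in> bcontfun" for \<phi>
  proof -
    have 1: "continuous_on {a..b} (\<lambda>t. inverse (W t) *\<^sub>R Y \<phi> t)"
      using W_pos by (intro continuous_intros W_cont Y_cont) (auto simp: less_le)
    have "bounded ((\<lambda>t. inverse (W t) *\<^sub>R Y \<phi> t) ` {a..b})"
      by (intro compact_imp_bounded compact_continuous_image 1) simp
    then have "bounded (range (\<lambda>t. inverse (W (c t)) *\<^sub>R Y \<phi> (c t)))"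
      by (rule bounded_subset) (use c_in in auto)
    moreover have "continuous_on UNIV (\<lambda>t. inverse (W (c t)) *\<^sub>R Y \<phi> (c t))"
      by (rule continuous_on_compose2[OF 1 c_cont]) (use c_in in auto)
    ultimately show ?thesis by (simp add: bcontfun_def)
  qed
  define T where "T \<phi> = Bcontfun (\<lambda>t. inverse (W (c t)) *\<^sub>R Y \<phi> (c t))" for \<phi>
  have T: "apply_bcontfun (T \<phi>) t = inverse (W (c t)) *\<^sub>R Y \<phi> (c t)" for \<phi> t
    unfolding T_def by (simp add: Bcontfun_inverse[OF bc])
  have contr: "dist (T \<phi>) (T \<psi>) \<le> 1/2 * dist \<phi> \<psi>" for \<phi> \<psi>
  proof (rule dist_bound)
    fix t
    define d where "d = dist \<phi> \<psi>"
    have "d \<ge> 0" by (simp add: d_def)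
    have Y_diff: "norm (Y \<phi> s - Y \<psi> s) \<le> d / 2 * W s" if s: "s \<in> {a..b}" for s
    proof (cases "s = a")
      case True
      then show ?thesis using \<open>d \<ge> 0\<close> W_pos[of a] by (simp add: Y_def)
    next
      case False
      with s have "a < s" by simp
      have "norm ((Y \<phi> s - Y \<psi> s) - (Y \<phi> a - Y \<psi> a)) \<le> d / 2 * W s - d / 2 * W a"
      proof (rule differentiable_bound_general[OF \<open>a < s\<close>,
            where f' = "\<lambda>r. G \<phi> r - G \<psi> r" and \<phi>' = "\<lambda>r. d * L * W r"])
        show "continuous_on {a..s} (\<lambda>r. Y \<phi> r - Y \<psi> r)"
          using s by (intro continuous_intros continuous_on_subset[OF Y_cont]) auto
        show "continuous_on {a..s} (\<lambda>r. d / 2 * W r)"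
          by (intro continuous_intros W_cont)
        fix r assume r: "a < r" "r < s"
        then have "r \<in> {a..b}" "at r within {a..b} = at r"
          using s by (auto simp: at_within_Icc_at)
        then show "((\<lambda>r. Y \<phi> r - Y \<psi> r) has_vector_derivative G \<phi> r - G \<psi> r) (at r)"
          using Y_deriv[of r \<phi>] Y_deriv[of r \<psi>] by (auto intro!: derivative_intros)
        show "((\<lambda>r. d / 2 * W r) has_vector_derivative d * L * W r) (at r)"
          unfolding W_def has_real_derivative_iff_has_vector_derivative[symmetric]
          by (auto intro!: derivative_eq_intros)
        have "norm (G \<phi> r - G \<psi> r) \<le> L * norm (W r *\<^sub>R apply_bcontfun \<phi> r - W r *\<^sub>R apply_bcontfun \<psi> r)"
          unfolding G_def by (rule lip)
        also have "\<dots> = L * (W r * dist (apply_bcontfun \<phi> r) (apply_bcontfun \<psi> r))"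
          using W_pos[of r] by (simp add: dist_norm flip: scaleR_diff_right)
        also have "\<dots> \<le> L * (W r * d)"
          unfolding d_def using \<open>L > 0\<close> W_pos[of r] by (intro mult_left_mono dist_bounded) auto
        finally show "norm (G \<phi> r - G \<psi> r) \<le> d * L * W r" by (simp add: mult_ac)
      qed
      also have "\<dots> \<le> d / 2 * W s" using \<open>d \<ge> 0\<close> W_pos[of a] by simp
      finally show ?thesis by (simp add: Y_def)
    qed
    have "dist (apply_bcontfun (T \<phi>) t) (apply_bcontfun (T \<psi>) t)
        = inverse (W (c t)) * norm (Y \<phi> (c t) - Y \<psi> (c t))"
      using W_pos[of "c t"] by (simp add: T dist_norm flip: scaleR_diff_right)
    also have "\<dots> \<le> inverse (W (c t)) * (d / 2 * W (c t))"
      using W_pos[of "c t"] by (intro mult_left_mono Y_diff c_in) auto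
    also have "\<dots> = 1/2 * d" using W_pos[of "c t"] by simp
    finally show "dist (apply_bcontfun (T \<phi>) t) (apply_bcontfun (T \<psi>) t) \<le> 1/2 * dist \<phi> \<psi>"
      by (simp add: d_def)
  qed
  obtain \<phi> where \<phi>: "T \<phi> = \<phi>"
    using banach_fix_type[of "1/2" T] contr by auto
  have fix_eq: "W t *\<^sub>R apply_bcontfun \<phi> t = Y \<phi> t" if "t \<in> {a..b}" for t
  proof -
    have "c t = t" using that by (auto simp: c_def)
    then have "apply_bcontfun \<phi> t = inverse (W t) *\<^sub>R Y \<phi> t" using T[of \<phi> t] \<phi> by simp
    then show ?thesis using W_pos[of t] by simp
  qed
  show ?thesis
  proof (intro exI conjI ballI)
    show "Y \<phi> a = x0" by (simp add: Y_def)
    show "(Y \<phi> has_vector_derivative F t (Y \<phi> t)) (at t within {a..b})" if "t \<in> {a..b}" for t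
      using Y_deriv[OF that, of \<phi>] fix_eq[OF that] by (simp add: G_def)
  qed
qed

subsection \<open>Periodic impulse moments\<close>

locale impulse_times =
  fixes \<theta> :: "int \<Rightarrow> real" and p :: nat and \<omega> :: real
  assumes theta_mono: "strict_mono \<theta>"
    and theta_per: "\<theta> (k + int p) = \<theta> k + \<omega>"
    and omega_pos: "\<omega> > 0"
begin

lemma theta_less_iff [simp]: "\<theta> j < \<theta> k \<longleftrightarrow> j < k"
  using theta_mono by (rule strict_mono_less)

lemma theta_le_iff [simp]: "\<theta> j \<le> \<theta> k \<longleftrightarrow> j \<le> k"
  using theta_mono by (rule strict_mono_less_eq)

lemma p_pos: "p > 0"
  using theta_per[of 0] omega_pos by (cases "p = 0") auto

lemma theta_shift: "\<theta> (k + j * int p) = \<theta> k + of_int j * \<omega>"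
proof (induction j rule: int_induct[where k = 0])
  case (step1 i)
  then show ?case using theta_per[of "k + i * int p"] by (simp add: algebra_simps)
next
  case (step2 i)
  then show ?case using theta_per[of "k + (i - 1) * int p"] by (simp add: algebra_simps)
qed simp

text \<open>Periodicity makes \<theta> unbounded in both directions. Hence only finitely many
  indices compete for being the last one with \<theta>_k < t.\<close>

lemma theta_bracket: "\<exists>k. \<theta> k < t \<and> t \<le> \<theta> (k + 1)"
proof -
  define S where "S = {k. \<theta> k < t}"
  define j1 where "j1 = \<lceil>(t - \<theta> 0) / \<omega>\<rceil>"
  \<comment> \<open>Subtracting 1 from the ceiling gives a strict inequality, as the open left end
    of a gap demands.\<close>
  define j0 where "j0 = \<lceil>(t - \<theta> 0) / \<omega>\<rceil> - 1"
  have "(t - \<theta> 0) / \<omega> \<le> of_int j1" "of_int j0 < (t - \<theta> 0) / \<omega>"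
    by (simp_all add: j1_def j0_def) linarith
  then have 1: "t \<le> \<theta> (j1 * int p)" "\<theta> (j0 * int p) < t"
    using omega_pos theta_shift[of 0 j1] theta_shift[of 0 j0] by (simp_all add: field_simps)
  define T where "T = S \<inter> {j0 * int p..j1 * int p}"
  have "\<theta> (j0 * int p) < \<theta> (j1 * int p)" using 1 by linarith
  then have le: "j0 * int p < j1 * int p" by simp
  have fin: "finite T" and ne: "j0 * int p \<in> T" using 1 le by (auto simp: T_def S_def)
  have "Max T \<in> T" using fin ne by (intro Max_in) auto
  have "t \<le> \<theta> (Max T + 1)"
  proof (rule ccontr)
    assume *: "\<not> t \<le> \<theta> (Max T + 1)"
    then have "\<theta> (Max T + 1) < \<theta> (j1 * int p)" using 1 by linarith
    then have "Max T + 1 \<in> T" using * \<open>Max T \<in> T\<close> by (auto simp: T_def S_def)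
    then show False using Max_ge[OF fin] by force
  qed
  then show ?thesis using \<open>Max T \<in> T\<close> by (auto simp: T_def S_def)
qed

text \<open>The gaps are open on the left and closed on the right, in accordance with left
  continuity and with the half-open window counted by \<open>icount\<close>. Counting impulses
  thereby becomes subtraction of indices.\<close>

definition idx :: "real \<Rightarrow> int" where
  "idx t = (SOME k. \<theta> k < t \<and> t \<le> \<theta> (k + 1))"

lemma idx: "\<theta> (idx t) < t" "t \<le> \<theta> (idx t + 1)"
  using someI_ex[OF theta_bracket[of t]] by (auto simp: idx_def)

lemma theta_less_iff_idx: "\<theta> k < t \<longleftrightarrow> k \<le> idx t"
proof
  assume "\<theta> k < t"
  then have "\<theta> k < \<theta> (idx t + 1)" using idx(2)[of t] by linarith
  then show "k \<le> idx t" by simp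
next
  assume "k \<le> idx t"
  then have "\<theta> k \<le> \<theta> (idx t)" by simp
  then show "\<theta> k < t" using idx(1)[of t] by linarith
qed

lemma le_theta_iff_idx: "t \<le> \<theta> k \<longleftrightarrow> idx t < k"
  using theta_less_iff_idx[of k t] by linarith

lemma idx_eqI: "\<theta> k < t \<Longrightarrow> t \<le> \<theta> (k + 1) \<Longrightarrow> idx t = k"
  unfolding theta_less_iff_idx le_theta_iff_idx by simp

lemma idx_theta [simp]: "idx (\<theta> k) = k - 1"
  by (rule idx_eqI) auto

lemma idx_mono: "s \<le> t \<Longrightarrow> idx s \<le> idx t"
  using idx(1)[of s] theta_less_iff_idx[of "idx s" t] by linarith

lemma idx_shift: "idx (t + of_int j * \<omega>) = idx t + j * int p"
proof (rule idx_eqI)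
  have "idx t + j * int p + 1 = (idx t + 1) + j * int p" by simp
  then show "t + of_int j * \<omega> \<le> \<theta> (idx t + j * int p + 1)"
    using idx(2)[of t] theta_shift[of "idx t + 1" j] by (metis add_right_mono)
qed (simp add: theta_shift idx)

lemma range_theta_shift: "t + of_int j * \<omega> \<in> range \<theta> \<longleftrightarrow> t \<in> range \<theta>"
proof -
  have fwd: "s + of_int i * \<omega> \<in> range \<theta>" if "s \<in> range \<theta>" for s i
    using that theta_shift[of _ i] by (metis (no_types, lifting) imageE rangeI)
  show ?thesis
    using fwd[of t j] fwd[of "t + of_int j * \<omega>" "- j"] by auto
qed

lemma between_notin_range: "\<theta> k < t \<Longrightarrow> t < \<theta> (k + 1) \<Longrightarrow> t \<notin> range \<theta>"
  by auto

lemma icount_eq: "icount \<theta> s t = nat (idx t - idx s)"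
proof -
  have "{k. s \<le> \<theta> k \<and> \<theta> k < t} = {idx s<..idx t}"
    unfolding theta_less_iff_idx le_theta_iff_idx by auto
  then show ?thesis by (simp add: icount_def)
qed

text \<open>The window is enlarged to a whole number of periods, each with exactly \<open>p\<close>
  moments. The \<open>+ 1\<close> pays for this rounding.\<close>

lemma icount_le:
  assumes "s \<le> t"
  shows "real (icount \<theta> s t) \<le> real p * ((t - s) / \<omega> + 1)"
proof -
  define j where "j = \<lceil>(t - s) / \<omega>\<rceil>"
  have "(t - s) / \<omega> \<le> of_int j" and j: "of_int j \<le> (t - s) / \<omega> + 1"
    by (simp_all add: j_def)
  then have "t \<le> s + of_int j * \<omega>" using omega_pos by (simp add: field_simps)
  then have "idx t \<le> idx s + j * int p" using idx_mono idx_shift by metis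
  then have "real (icount \<theta> s t) \<le> real_of_int (j * int p)"
    using idx_mono[OF assms] by (simp only: icount_eq)
  also have "\<dots> \<le> ((t - s) / \<omega> + 1) * real p"
    using j by (auto intro: mult_right_mono)
  finally show ?thesis by (simp add: mult.commute)
qed

end

subsection \<open>An impulsive Gronwall inequality\<close>

locale linear_impulsive = impulse_times +
  fixes A B :: "real^'m^'m" and N lam :: real
  assumes commute: "A ** B = B ** A"
    and N_pos: "N > 0" and lam_pos: "lam > 0"
    and matriciant_bound: "s \<le> t \<Longrightarrow> mnorm (matriciant \<theta> A B t s) \<le> N * exp (- lam * (t - s))"
begin

text \<open>The matriciant with its number of impulses made an independent parameter. For fixed
  \<open>n\<close> it is differentiable in \<open>t\<close>, whereas \<open>matriciant\<close> jumps
  in the initial time.\<close>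

definition propagator :: "nat \<Rightarrow> real \<Rightarrow> real^'m^'m" where
  "propagator n t = mexp (t *\<^sub>R A) ** mpow (mat 1 + B) n"

lemma matriciant_eq_propagator:
  "s \<le> t \<Longrightarrow> matriciant \<theta> A B t s = propagator (icount \<theta> s t) (t - s)"
  by (auto simp: matriciant_def propagator_def icount_eq)

lemma norm_matriciant_mult_le:
  "s \<le> t \<Longrightarrow> norm (matriciant \<theta> A B t s *v v) \<le> N * exp (- lam * (t - s)) * norm v"
  using norm_matrix_vector_mult_le[of "matriciant \<theta> A B t s" v] matriciant_bound[of s t]
    mult_right_mono[OF matriciant_bound, of s t "norm v"] by simp

lemma propagator_Suc: "propagator (Suc n) t = propagator n t ** (mat 1 + B)"
  by (simp only: propagator_def mpow_Suc_right matrix_mul_assoc)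

text \<open>\<open>A\<close> passes through the impulse factors because it commutes with
  \<open>I + B\<close>. Thus the derivative of the exponential becomes a right factor
  \<open>A\<close> of the whole product, where it can act on a solution.\<close>

lemma propagator_commute: "propagator n t ** A = mexp (t *\<^sub>R A) ** A ** mpow (mat 1 + B) n"
proof -
  have "A ** (mat 1 + B) = (mat 1 + B) ** A"
    by (simp add: matrix_add_ldistrib commute
        bounded_bilinear.add_left[OF bounded_bilinear_matrix_matrix_mult])
  from mpow_commute[OF this, of n] show ?thesis
    by (simp add: propagator_def matrix_mul_assoc[symmetric])
qed

lemma propagator_has_vector_derivative:
  "((\<lambda>r. propagator n (t - r)) has_vector_derivative - (propagator n (t - r) ** A)) (at r within S)"
proof -
  have "((\<lambda>r. mexp (r *\<^sub>R A)) has_vector_derivative mexp ((t - r) *\<^sub>R A) ** A) (at (t - r))"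
    by (rule mexp_scaleR_has_vector_derivative)
  moreover have "((\<lambda>r. t - r) has_vector_derivative - 1) (at r within S)"
    by (auto intro!: derivative_eq_intros)
  ultimately have "((\<lambda>r. mexp ((t - r) *\<^sub>R A)) has_vector_derivative
      - (mexp ((t - r) *\<^sub>R A) ** A)) (at r within S)"
    using vector_diff_chain_within[of "\<lambda>r. t - r" "-1" r S "\<lambda>r. mexp (r *\<^sub>R A)"]
      has_vector_derivative_at_within by (fastforce simp: o_def)
  from bounded_linear.has_vector_derivative[OF
      bounded_bilinear.bounded_linear_left[OF bounded_bilinear_matrix_matrix_mult] this]
  show ?thesis
    unfolding propagator_commute
    by (simp add: propagator_def bounded_bilinear.minus_left[OF bounded_bilinear_matrix_matrix_mult])
qed

text \<open>Variation of constants in differential form: the derivative of the propagator cancels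
  the term \<open>A *v u\<close>, and only the transported inhomogeneity remains.\<close>

lemma propagator_mult_has_vector_derivative:
  assumes "(u has_vector_derivative A *v u r + F) (at r within S)"
  shows "((\<lambda>r. propagator n (t - r) *v u r) has_vector_derivative propagator n (t - r) *v F) (at r within S)"
proof -
  have "((\<lambda>r. propagator n (t - r) *v u r) has_vector_derivative
      propagator n (t - r) *v (A *v u r + F) + - (propagator n (t - r) ** A) *v u r) (at r within S)"
    by (rule bounded_bilinear.has_vector_derivative[OF bounded_bilinear_matrix_vector_mult
          propagator_has_vector_derivative assms])
  then show ?thesis
    by (simp add: matrix_vector_right_distrib matrix_vector_mul_assoc
        bounded_bilinear.minus_left[OF bounded_bilinear_matrix_vector_mult])
qed

lemma propagator_continuous_on: "continuous_on S (\<lambda>r. propagator n (t - r))"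
  unfolding continuous_on_eq_continuous_within
  using has_vector_derivative_continuous[OF propagator_has_vector_derivative] by blast

lemma matriciant_eq_propagator_gap:
  assumes "r \<le> \<beta>" "\<beta> \<le> t" "idx r = idx \<beta>"
  shows "matriciant \<theta> A B t r = propagator (icount \<theta> \<beta> t) (t - r)"
  using assms by (simp add: matriciant_eq_propagator icount_eq)

text \<open>The bound extends to the left end point \<alpha> by continuity, although the matriciant itself may
  jump there.\<close>
lemma norm_propagator_mult_le:
  assumes "\<alpha> < \<beta>" "\<beta> \<le> t" and gap: "\<And>r. \<alpha> < r \<Longrightarrow> r \<le> \<beta> \<Longrightarrow> idx r = idx \<beta>"
    and r: "\<alpha> \<le> r" "r \<le> \<beta>"
  shows "norm (propagator (icount \<theta> \<beta> t) (t - r) *v v) \<le> N * exp (- lam * (t - r)) * norm v"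
proof -
  let ?P = "\<lambda>r. norm (propagator (icount \<theta> \<beta> t) (t - r) *v v)"
  let ?Q = "\<lambda>r. N * exp (- lam * (t - r)) * norm v"
  have le: "?P r \<le> ?Q r" if "\<alpha> < r" "r \<le> \<beta>" for r
    using norm_matriciant_mult_le[of r t v] matriciant_eq_propagator_gap[OF that(2) assms(2) gap[OF that]]
      that(2) assms(2) by simp
  show ?thesis
  proof (cases "r = \<alpha>")
    case True
    have "continuous_on UNIV ?P"
      by (intro continuous_intros bounded_bilinear.continuous_on[OF bounded_bilinear_matrix_vector_mult]
          propagator_continuous_on)
    then have "(?P \<longlongrightarrow> ?P \<alpha>) (at_right \<alpha>)"
      using tendsto_within_subset[of ?P _ \<alpha> UNIV "{\<alpha><..}"] by (simp add: continuous_on_def)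
    moreover have "(?Q \<longlongrightarrow> ?Q \<alpha>) (at_right \<alpha>)"
      by (intro tendsto_intros)
    moreover have "eventually (\<lambda>r. ?P r \<le> ?Q r) (at_right \<alpha>)"
      using eventually_at_right_real[OF \<open>\<alpha> < \<beta>\<close>] by (rule eventually_mono) (use le in auto)
    ultimately have "?P \<alpha> \<le> ?Q \<alpha>"
      by (intro tendsto_le[of "at_right \<alpha>" ?Q _ ?P]) auto
    then show ?thesis using True by simp
  qed (use le[of r] r in auto)
qed

text \<open>The required shape of the bound on \<open>F\<close> makes everything explicit. Transport
  from \<open>r\<close> to \<open>t\<close> costs \<open>N * exp (- lam * (t - r))\<close>, and
  together with \<open>exp (- lam * (r - s))\<close> this no longer depends on \<open>r\<close>. The
  remaining factor \<open>N * a * exp (N * a * (r - s))\<close> is an exact derivative.\<close>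

lemma transport_gap:
  assumes "\<alpha> < \<beta>" "\<beta> \<le> t" and gap: "\<And>r. \<alpha> < r \<Longrightarrow> r \<le> \<beta> \<Longrightarrow> idx r = idx \<beta>"
    and deriv: "\<And>r. \<alpha> < r \<Longrightarrow> r < \<beta> \<Longrightarrow> \<exists>F. (u has_vector_derivative A *v u r + F) (at r) \<and>
                  norm F \<le> c * exp (- lam * (r - s)) * (a * exp (N * a * (r - s)))"
    and right: "(u \<longlongrightarrow> l) (at_right \<alpha>)" and left: "(u \<longlongrightarrow> u \<beta>) (at_left \<beta>)"
  shows "norm (matriciant \<theta> A B t \<beta> *v u \<beta>) \<le> norm (propagator (icount \<theta> \<beta> t) (t - \<alpha>) *v l)
           + exp (- lam * (t - s)) * c * (exp (N * a * (\<beta> - s)) - exp (N * a * (\<alpha> - s)))"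
proof -
  let ?n = "icount \<theta> \<beta> t"
  \<comment> \<open>At \<alpha> the function may jump. Replacing its value there by the right limit
    makes it continuous on the closed interval.\<close>
  define v where "v r = (if r \<le> \<alpha> then l else u r)" for r
  define w where "w r = propagator ?n (t - r) *v v r" for r
  obtain F where F: "\<And>r. \<alpha> < r \<Longrightarrow> r < \<beta> \<Longrightarrow> (u has_vector_derivative A *v u r + F r) (at r)"
      "\<And>r. \<alpha> < r \<Longrightarrow> r < \<beta> \<Longrightarrow> norm (F r) \<le> c * exp (- lam * (r - s)) * (a * exp (N * a * (r - s)))"
    using deriv by metis
  have v_cont: "continuous_on {\<alpha>..\<beta>} v"
  proof (rule continuous_on_IccI)
    show "(v \<longlongrightarrow> v \<alpha>) (at_right \<alpha>)"
      using right eventually_at_right_less[of \<alpha>]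
      by (auto simp: v_def elim!: Lim_transform_eventually eventually_mono)
    have "eventually (\<lambda>x. u x = v x) (at_left \<beta>)"
      using eventually_at_leftI[of \<alpha> \<beta> "\<lambda>x. x > \<alpha>"] \<open>\<alpha> < \<beta>\<close>
      by (auto simp: v_def elim!: eventually_mono)
    then show "(v \<longlongrightarrow> v \<beta>) (at_left \<beta>)"
      using Lim_transform_eventually[OF left] \<open>\<alpha> < \<beta>\<close> by (simp add: v_def)
    show "v \<midarrow>x\<rightarrow> v x" if "\<alpha> < x" "x < \<beta>" for x
    proof -
      have "eventually (\<lambda>y. u y = v y) (at x)"
        using order_tendstoD(1)[OF tendsto_ident_at \<open>\<alpha> < x\<close>, of UNIV]
        by (auto simp: v_def elim!: eventually_mono)
      moreover have "u \<midarrow>x\<rightarrow> u x"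
        using has_vector_derivative_continuous[OF F(1)[OF that]] by (simp add: isCont_def)
      ultimately show ?thesis using Lim_transform_eventually \<open>\<alpha> < x\<close> by (fastforce simp: v_def)
    qed
  qed (use \<open>\<alpha> < \<beta>\<close> in auto)
  have "norm (w \<beta> - w \<alpha>) \<le> exp (- lam * (t - s)) * c * exp (N * a * (\<beta> - s))
      - exp (- lam * (t - s)) * c * exp (N * a * (\<alpha> - s))"
  proof (rule differentiable_bound_general[OF \<open>\<alpha> < \<beta>\<close>,
        where f' = "\<lambda>r. propagator ?n (t - r) *v F r"
          and \<phi>' = "\<lambda>r. exp (- lam * (t - s)) * c * (N * a * exp (N * a * (r - s)))"])
    show "continuous_on {\<alpha>..\<beta>} w"
      unfolding w_def
      by (intro bounded_bilinear.continuous_on[OF bounded_bilinear_matrix_vector_mult]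
          propagator_continuous_on v_cont)
    show "continuous_on {\<alpha>..\<beta>} (\<lambda>r. exp (- lam * (t - s)) * c * exp (N * a * (r - s)))"
      by (intro continuous_intros)
    fix r assume r: "\<alpha> < r" "r < \<beta>"
    have "((\<lambda>r. propagator ?n (t - r) *v u r) has_vector_derivative propagator ?n (t - r) *v F r) (at r)"
      by (rule propagator_mult_has_vector_derivative[OF F(1)[OF r]])
    then show "(w has_vector_derivative propagator ?n (t - r) *v F r) (at r)"
      by (rule has_vector_derivative_transform_within_open[where S = "{\<alpha><..<\<beta>}"])
         (use r in \<open>auto simp: w_def v_def\<close>)
    show "((\<lambda>r. exp (- lam * (t - s)) * c * exp (N * a * (r - s))) has_vector_derivative
        exp (- lam * (t - s)) * c * (N * a * exp (N * a * (r - s)))) (at r)"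
      unfolding has_real_derivative_iff_has_vector_derivative[symmetric]
      by (auto intro!: derivative_eq_intros)
    have "norm (propagator ?n (t - r) *v F r) \<le> N * exp (- lam * (t - r)) * norm (F r)"
      using r by (intro norm_propagator_mult_le[OF assms(1,2)] gap) auto
    also have "\<dots> \<le> N * exp (- lam * (t - r)) * (c * exp (- lam * (r - s)) * (a * exp (N * a * (r - s))))"
      using r N_pos by (intro mult_left_mono F(2)) auto
    also have "\<dots> = (exp (- lam * (t - r)) * exp (- lam * (r - s))) * c * (N * a * exp (N * a * (r - s)))"
      by simp
    also have "exp (- lam * (t - r)) * exp (- lam * (r - s)) = exp (- lam * (t - s))"
      by (simp add: algebra_simps flip: exp_add)
    finally show "norm (propagator ?n (t - r) *v F r) \<le> exp (- lam * (t - s)) * c * (N * a * exp (N * a * (r - s)))" .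
  qed
  moreover have "w \<beta> = matriciant \<theta> A B t \<beta> *v u \<beta>" "w \<alpha> = propagator ?n (t - \<alpha>) *v l"
    using \<open>\<alpha> < \<beta>\<close> \<open>\<beta> \<le> t\<close> by (simp_all add: w_def v_def matriciant_eq_propagator)
  ultimately show ?thesis
    using norm_triangle_sub[of "w \<beta>" "w \<alpha>"] by (simp add: algebra_simps)
qed

text \<open>The linear impulsive system up to errors measured against a free weight
  \<open>w\<close>, so that the weight may later depend on \<open>u\<close> itself. A jump is
  required only strictly before \<open>T\<close>, since a right limit at \<open>T\<close> would look
  outside the window.\<close>

definition perturbed :: "real \<Rightarrow> real \<Rightarrow> (real \<Rightarrow> real) \<Rightarrow> real \<Rightarrow> real \<Rightarrow> (real \<Rightarrow> real^'m) \<Rightarrow> bool" where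
  "perturbed s T w a b u \<longleftrightarrow>
     (\<forall>r. s < r \<and> r \<le> T \<and> r \<notin> range \<theta> \<longrightarrow>
        (\<exists>F. (u has_vector_derivative A *v u r + F) (at r) \<and> norm F \<le> a * w r)) \<and>
     (s \<notin> range \<theta> \<longrightarrow> continuous (at_right s) u) \<and>
     (\<forall>k. s < \<theta> k \<and> \<theta> k \<le> T \<longrightarrow> continuous (at_left (\<theta> k)) u) \<and>
     (\<forall>k. s \<le> \<theta> k \<and> \<theta> k < T \<longrightarrow>
        (\<exists>J. (u \<longlongrightarrow> u (\<theta> k) + B *v u (\<theta> k) + J) (at_right (\<theta> k)) \<and> norm J \<le> b * w (\<theta> k)))"

text \<open>The scalar Gronwall majorant: it starts at 1, has logarithmic derivative
  \<open>N * a\<close> between impulses, and is multiplied by \<open>1 + N * b\<close> at each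
  impulse.\<close>

definition growth :: "real \<Rightarrow> real \<Rightarrow> real \<Rightarrow> real \<Rightarrow> real" where
  "growth a b s r = (1 + N * b) ^ icount \<theta> s r * exp (N * a * (r - s))"

section \<open>One-sided limits and boundedness of perturbed solutions\<close>

lemma perturbed_subset: "perturbed s T w a b u \<Longrightarrow> t \<le> T \<Longrightarrow> perturbed s t w a b u"
  unfolding perturbed_def by (meson order_trans order_less_le_trans)

lemma perturbed_derivD:
  assumes "perturbed s T w a b u" "s < r" "r \<le> T" "r \<notin> range \<theta>"
  obtains F where "(u has_vector_derivative A *v u r + F) (at r)" "norm F \<le> a * w r"
  using assms unfolding perturbed_def by blast

lemma perturbed_jumpD:
  assumes "perturbed s T w a b u" "s \<le> \<theta> k" "\<theta> k < T"
  obtains J where "(u \<longlongrightarrow> u (\<theta> k) + B *v u (\<theta> k) + J) (at_right (\<theta> k))" "norm J \<le> b * w (\<theta> k)"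
  using assms unfolding perturbed_def by blast

lemma perturbed_continuous:
  assumes "perturbed s T w a b u" "s < r" "r \<le> T" "r \<notin> range \<theta>"
  shows "isCont u r"
  using perturbed_derivD[OF assms] has_vector_derivative_continuous by blast

lemma perturbed_tendsto_left:
  assumes "perturbed s T w a b u" "s < r" "r \<le> T"
  shows "(u \<longlongrightarrow> u r) (at_left r)"
proof (cases "r \<in> range \<theta>")
  case True
  then show ?thesis using assms by (auto simp: perturbed_def continuous_within)
next
  case False
  then show ?thesis
    using perturbed_continuous[OF assms False] by (simp add: continuous_at_imp_continuous_at_within flip: continuous_within)
qed

lemma perturbed_tendsto_right:
  assumes "perturbed s T w a b u" "s \<le> r" "r < T"
  obtains l where "(u \<longlongrightarrow> l) (at_right r)"
proof (cases "r \<in> range \<theta>")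
  case True
  then obtain k where "r = \<theta> k" by auto
  then show ?thesis using perturbed_jumpD[of s T w a b u k] assms that by blast
next
  case False
  show ?thesis
  proof (cases "r = s")
    case True
    then show ?thesis using assms False that by (auto simp: perturbed_def continuous_within)
  next
    case False
    then have "isCont u r"
      using perturbed_continuous[OF assms(1)] assms \<open>r \<notin> range \<theta>\<close> by auto
    then show ?thesis
      using continuous_at_imp_continuous_at_within[of r u "{r<..}"] that by (auto simp: continuous_within)
  qed
qed

text \<open>A purely qualitative bound. Its purpose is to make the supremum in
  \<open>impulsive_gronwall\<close> finite.\<close>

lemma perturbed_bounded:
  assumes u: "perturbed s T w a b u" and "s \<le> T"
  shows "bounded (u ` {s..T})"
proof (rule bounded_image_if_locally_bounded[OF \<open>s \<le> T\<close>])
  fix x assume x: "s \<le> x" "x \<le> T"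
  have "\<exists>d>0. bounded (u ` ({x - d<..<x} \<inter> {s..T}))"
  proof (cases "s < x")
    case True
    then obtain d where "d > 0" "bounded (u ` {x - d<..<x})"
      using tendsto_at_left_bounded_near[OF perturbed_tendsto_left[OF u]] x by blast
    then show ?thesis by (meson bounded_subset image_mono inf_le1)
  next
    case False
    then have "{x - 1<..<x} \<inter> {s..T} = {}" using x by auto
    then show ?thesis by (intro exI[of _ 1]) simp
  qed
  then obtain d1 where d1: "d1 > 0" "bounded (u ` ({x - d1<..<x} \<inter> {s..T}))" by blast
  have "\<exists>d>0. bounded (u ` ({x<..<x + d} \<inter> {s..T}))"
  proof (cases "x < T")
    case True
    then obtain l where "(u \<longlongrightarrow> l) (at_right x)" using perturbed_tendsto_right[OF u] x by blast
    then obtain d where "d > 0" "bounded (u ` {x<..<x + d})"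
      using tendsto_at_right_bounded_near by blast
    then show ?thesis by (meson bounded_subset image_mono inf_le1)
  next
    case False
    then have "{x<..<x + 1} \<inter> {s..T} = {}" using x by auto
    then show ?thesis by (intro exI[of _ 1]) simp
  qed
  then obtain d2 where d2: "d2 > 0" "bounded (u ` ({x<..<x + d2} \<inter> {s..T}))" by blast
  have "u ` ({x - min d1 d2<..<x + min d1 d2} \<inter> {s..T})
      \<subseteq> insert (u x) (u ` ({x - d1<..<x} \<inter> {s..T}) \<union> u ` ({x<..<x + d2} \<inter> {s..T}))"
  proof (rule image_subsetI)
    fix y assume "y \<in> {x - min d1 d2<..<x + min d1 d2} \<inter> {s..T}"
    then have "y = x \<or> y \<in> {x - d1<..<x} \<inter> {s..T} \<or> y \<in> {x<..<x + d2} \<inter> {s..T}" by auto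
    then show "u y \<in> insert (u x) (u ` ({x - d1<..<x} \<inter> {s..T}) \<union> u ` ({x<..<x + d2} \<inter> {s..T}))"
      by blast
  qed
  moreover have "bounded (insert (u x) (u ` ({x - d1<..<x} \<inter> {s..T}) \<union> u ` ({x<..<x + d2} \<inter> {s..T})))"
    using d1 d2 by simp
  ultimately have "bounded (u ` ({x - min d1 d2<..<x + min d1 d2} \<inter> {s..T}))"
    using bounded_subset by blast
  then show "\<exists>d>0. bounded (u ` ({x - d<..<x + d} \<inter> {s..T}))"
    using d1 d2 by (intro exI[of _ "min d1 d2"]) auto
qed

lemma growth_refl [simp]: "growth a b s s = 1"
  by (simp add: growth_def icount_eq)

lemma growth_mono:
  assumes "a \<ge> 0" "b \<ge> 0" "s \<le> r" "r \<le> t"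
  shows "growth a b s r \<le> growth a b s t"
proof -
  have "idx r \<le> idx t" using assms by (intro idx_mono)
  then have "icount \<theta> s r \<le> icount \<theta> s t" by (simp add: icount_eq)
  then show ?thesis
    unfolding growth_def using assms N_pos
    by (intro mult_mono power_increasing) (auto intro!: mult_left_mono)
qed

lemma growth_ge_1: "a \<ge> 0 \<Longrightarrow> b \<ge> 0 \<Longrightarrow> s \<le> r \<Longrightarrow> 1 \<le> growth a b s r"
  using growth_mono[of a b s s r] by simp

text \<open>Along \<open>r\<close>, the vector \<open>U(t,r) u(r)\<close> moves only through the perturbations, and \<open>growth\<close> is
  chosen so that its own increments dominate these moves.\<close>
lemma perturbed_variation:
  assumes u: "perturbed s t w a b u" and nonneg: "a \<ge> 0" "b \<ge> 0" "q \<ge> 0"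
    and w: "\<And>r. s \<le> r \<Longrightarrow> r \<le> t \<Longrightarrow> w r \<le> q * exp (- lam * (r - s)) * growth a b s r"
  shows "s \<le> r \<Longrightarrow> r \<le> t \<Longrightarrow> norm (matriciant \<theta> A B t r *v u r)
      \<le> exp (- lam * (t - s)) * (N * norm (u s) + q * (growth a b s r - 1))"
\<comment> \<open>Induction on the number of moments in [s,r), with \<open>t\<close> fixed. The last
  gap before \<open>r\<close> is crossed by \<open>transport_gap\<close>, and the induction
  hypothesis is applied at the moment where that gap begins.\<close>
proof (induction "icount \<theta> s r" arbitrary: r rule: less_induct)
  case less
  show ?case
  proof (cases "r = s")
    case True
    then show ?thesis using norm_matriciant_mult_le[of s t "u s"] less.prems by (simp add: mult_ac)
  next
    case False
    with less.prems have "s < r" by simp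
    define k where "k = idx r"
    \<comment> \<open>On the last gap the impulse count is constant, so there
      \<open>q * growth a b s x\<close> is \<open>c\<close> times an exponential, as
      \<open>transport_gap\<close> expects.\<close>
    define c where "c = q * (1 + N * b) ^ icount \<theta> s r"
    have k: "\<theta> k < r" "r \<le> \<theta> (k + 1)" unfolding k_def by (rule idx)+
    have gap: "idx x = idx r" if "\<theta> k < x" "x \<le> r" for x
      using that k by (auto simp: k_def intro!: idx_eqI)
    have deriv: "\<exists>F. (u has_vector_derivative A *v u x + F) (at x) \<and>
        norm F \<le> c * exp (- lam * (x - s)) * (a * exp (N * a * (x - s)))"
      if x: "s < x" "\<theta> k < x" "x < r" for x
    proof -
      have "x \<notin> range \<theta>" using x k by (intro between_notin_range[of k]) auto
      then obtain F where F: "(u has_vector_derivative A *v u x + F) (at x)" "norm F \<le> a * w x"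
        using perturbed_derivD[OF u, of x] x less.prems by auto
      note F(2)
      also have "a * w x \<le> a * (q * exp (- lam * (x - s)) * growth a b s x)"
        using nonneg x less.prems by (intro mult_left_mono w) auto
      also have "\<dots> = c * exp (- lam * (x - s)) * (a * exp (N * a * (x - s)))"
        using gap[of x] x by (simp add: growth_def icount_eq c_def)
      finally show ?thesis using F(1) by blast
    qed
    have left: "(u \<longlongrightarrow> u r) (at_left r)"
      using perturbed_tendsto_left[OF u] \<open>s < r\<close> less.prems by auto
    show ?thesis
    proof (cases "\<theta> k < s")
      case True
      \<comment> \<open>There is no moment in [s,r): transport starts at \<open>s\<close> itself,
        and the induction hypothesis is not involved.\<close>
      have "s \<notin> range \<theta>" using True k \<open>s < r\<close> by (intro between_notin_range[of k]) auto
      then have right: "(u \<longlongrightarrow> u s) (at_right s)"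
        using u by (simp add: perturbed_def continuous_within)
      have "icount \<theta> s r = 0" using gap[of s] True \<open>s < r\<close> by (simp add: icount_eq)
      have "norm (matriciant \<theta> A B t r *v u r) \<le> norm (propagator (icount \<theta> r t) (t - s) *v u s)
           + exp (- lam * (t - s)) * c * (exp (N * a * (r - s)) - exp (N * a * (s - s)))"
        by (rule transport_gap[OF \<open>s < r\<close> less.prems(2) gap deriv right left]) (use True in auto)
      also have "propagator (icount \<theta> r t) (t - s) = matriciant \<theta> A B t s"
        using gap[of s] True \<open>s < r\<close> less.prems by (intro matriciant_eq_propagator_gap[symmetric]) auto
      also have "norm (\<dots> *v u s) \<le> N * exp (- lam * (t - s)) * norm (u s)"
        using less.prems by (intro norm_matriciant_mult_le) auto
      finally show ?thesis
        by (simp add: growth_def c_def \<open>icount \<theta> s r = 0\<close> algebra_simps)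
    next
      case False
      then have "s \<le> \<theta> k" by simp
      have ic: "icount \<theta> s r = Suc (icount \<theta> s (\<theta> k))"
        using \<open>s \<le> \<theta> k\<close> le_theta_iff_idx[of s k] by (simp add: icount_eq k_def)
      \<comment> \<open>The window [\<theta>_k, t) includes \<theta>_k, so the matriciant from
        \<theta>_k has one factor \<open>I + B\<close> more than \<open>?P\<close>. This factor
        accounts for the linear part of the jump.\<close>
      have ict: "icount \<theta> (\<theta> k) t = Suc (icount \<theta> r t)"
        using idx_mono[OF less.prems(2)] by (simp add: icount_eq k_def)
      let ?P = "propagator (icount \<theta> r t) (t - \<theta> k)"
      obtain J where J: "(u \<longlongrightarrow> u (\<theta> k) + B *v u (\<theta> k) + J) (at_right (\<theta> k))"
          "norm J \<le> b * w (\<theta> k)"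
        using perturbed_jumpD[OF u \<open>s \<le> \<theta> k\<close>] k less.prems by auto
      have "norm (matriciant \<theta> A B t r *v u r) \<le> norm (?P *v (u (\<theta> k) + B *v u (\<theta> k) + J))
           + exp (- lam * (t - s)) * c * (exp (N * a * (r - s)) - exp (N * a * (\<theta> k - s)))"
        by (rule transport_gap[OF k(1) less.prems(2) gap deriv J(1) left]) (use \<open>s \<le> \<theta> k\<close> in auto)
      moreover have "?P *v (u (\<theta> k) + B *v u (\<theta> k) + J) = matriciant \<theta> A B t (\<theta> k) *v u (\<theta> k) + ?P *v J"
      proof -
        have "matriciant \<theta> A B t (\<theta> k) = ?P ** (mat 1 + B)"
          using k less.prems by (simp add: matriciant_eq_propagator ict propagator_Suc)
        then show ?thesis
          by (simp add: matrix_vector_right_distrib matrix_vector_mult_add_rdistrib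
              flip: matrix_vector_mul_assoc)
      qed
      moreover have "norm (matriciant \<theta> A B t (\<theta> k) *v u (\<theta> k))
          \<le> exp (- lam * (t - s)) * (N * norm (u s) + q * (growth a b s (\<theta> k) - 1))"
        using \<open>s \<le> \<theta> k\<close> k less.prems by (intro less.hyps) (auto simp: ic)
      \<comment> \<open>This is exactly the increment of \<open>q * growth\<close> caused by the
        factor \<open>1 + N * b\<close> at \<theta>_k. Together with the increment along the gap it
        telescopes to \<open>growth a b s r\<close>.\<close>
      moreover have "norm (?P *v J) \<le> exp (- lam * (t - s)) * (q * (N * b * growth a b s (\<theta> k)))"
      proof -
        have "norm (?P *v J) \<le> N * exp (- lam * (t - \<theta> k)) * norm J"
          by (rule norm_propagator_mult_le[OF k(1) less.prems(2) gap]) (use k in auto)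
        also have "\<dots> \<le> N * exp (- lam * (t - \<theta> k)) * (b * (q * exp (- lam * (\<theta> k - s)) * growth a b s (\<theta> k)))"
          using \<open>s \<le> \<theta> k\<close> k less.prems N_pos nonneg
          by (intro mult_left_mono order_trans[OF J(2)] w) auto
        also have "\<dots> = (exp (- lam * (t - \<theta> k)) * exp (- lam * (\<theta> k - s))) * (q * (N * b * growth a b s (\<theta> k)))"
          by simp
        also have "exp (- lam * (t - \<theta> k)) * exp (- lam * (\<theta> k - s)) = exp (- lam * (t - s))"
          by (simp add: algebra_simps flip: exp_add)
        finally show ?thesis .
      qed
      ultimately have "norm (matriciant \<theta> A B t r *v u r)
          \<le> exp (- lam * (t - s)) * (N * norm (u s) + q * (growth a b s (\<theta> k) - 1))
            + exp (- lam * (t - s)) * (q * (N * b * growth a b s (\<theta> k)))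
            + exp (- lam * (t - s)) * c * (exp (N * a * (r - s)) - exp (N * a * (\<theta> k - s)))"
        using norm_triangle_ineq[of "matriciant \<theta> A B t (\<theta> k) *v u (\<theta> k)" "?P *v J"] by simp
      also have "\<dots> = exp (- lam * (t - s)) * (N * norm (u s) + q * (growth a b s r - 1))"
        by (simp add: growth_def c_def ic algebra_simps)
      finally show ?thesis .
    qed
  qed
qed

text \<open>With \<open>q\<close> the supremum of \<open>(norm u + e) / (exp (- lam (r - s)) growth)\<close>, the variation bound
  improves \<open>q\<close> strictly unless \<open>q\<close> is at most the asserted constant.\<close>
lemma impulsive_gronwall:
  assumes u: "perturbed s T (\<lambda>r. norm (u r) + e) a b u" and nonneg: "a \<ge> 0" "b \<ge> 0" "e \<ge> 0"
    and t: "s \<le> t" "t \<le> T"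
  shows "norm (u t) + e
      \<le> exp (- lam * (t - s)) * growth a b s t * (N * norm (u s) + e * exp (lam * (T - s)))"
proof -
  define \<Psi> where "\<Psi> r = exp (- lam * (r - s)) * growth a b s r" for r
  define X where "X = N * norm (u s) + e * exp (lam * (T - s))"
  define Q where "Q r = (norm (u r) + e) / \<Psi> r" for r
  define q where "q = (SUP r\<in>{s..T}. Q r)"
  have \<Psi>_pos: "\<Psi> r > 0" if "s \<le> r" for r
    using growth_ge_1[OF nonneg(1,2) that] by (simp add: \<Psi>_def)
  have "s \<le> T" using t by simp
  obtain M where "\<forall>x\<in>u ` {s..T}. norm x \<le> M"
    using perturbed_bounded[OF u \<open>s \<le> T\<close>] unfolding bounded_iff by blast
  then have M: "norm (u r) \<le> M" if "r \<in> {s..T}" for r using that by blast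
  have bdd: "bdd_above (Q ` {s..T})"
  proof (rule bdd_aboveI2)
    fix r assume r: "r \<in> {s..T}"
    have "exp (- lam * (T - s)) * 1 \<le> \<Psi> r"
      unfolding \<Psi>_def using r lam_pos growth_ge_1[OF nonneg(1,2), of s r]
      by (intro mult_mono) auto
    moreover have "0 \<le> M" using M[OF r] norm_ge_zero[of "u r"] by linarith
    ultimately show "Q r \<le> (M + e) / exp (- lam * (T - s))"
      unfolding Q_def using M[OF r] nonneg by (intro frac_le) auto
  qed
  have q_ge: "Q r \<le> q" if "s \<le> r" "r \<le> T" for r
    unfolding q_def using that by (intro cSUP_upper bdd) auto
  have "0 \<le> Q s" unfolding Q_def using nonneg \<Psi>_pos[of s] by simp
  then have "q \<ge> 0" using q_ge[of s] \<open>s \<le> T\<close> by linarith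
  \<comment> \<open>The right side is an average of \<open>q\<close> and \<open>X\<close> with
    weight \<open>1 / growth\<close> on \<open>X\<close>. That weight is at least
    \<open>1 / growth a b s T\<close>, so \<open>q > X\<close> would keep every \<open>Q r\<close>
    below \<open>q\<close> by a fixed amount.\<close>
  have step: "Q r \<le> q + (X - q) / growth a b s r" if r: "s \<le> r" "r \<le> T" for r
  proof -
    define g where "g = growth a b s r"
    define E where "E = exp (- lam * (r - s))"
    have "g \<ge> 1" unfolding g_def using r nonneg by (intro growth_ge_1)
    have "E > 0" by (simp add: E_def)
    have "norm (u x) + e \<le> q * exp (- lam * (x - s)) * growth a b s x" if "s \<le> x" "x \<le> r" for x
      using q_ge[of x] \<Psi>_pos[of x] that r by (simp add: Q_def \<Psi>_def field_simps)
    from perturbed_variation[OF perturbed_subset[OF u r(2)] nonneg(1,2) \<open>q \<ge> 0\<close> this, of r]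
    have "norm (u r) \<le> E * (N * norm (u s) + q * (g - 1))"
      using r by (simp add: matriciant_def E_def g_def)
    \<comment> \<open>The constant \<open>e\<close> does not decay. Since \<open>r \<le> T\<close>,
      it can still be written below the decaying exponential, at the cost of
      \<open>exp (lam * (T - s))\<close> in \<open>X\<close>.\<close>
    moreover have "e * 1 \<le> e * (E * exp (lam * (T - s)))"
      using nonneg lam_pos r by (intro mult_left_mono) (auto simp: E_def algebra_simps simp flip: exp_add)
    ultimately have "norm (u r) + e \<le> E * (X + q * (g - 1))"
      by (simp add: X_def algebra_simps)
    then have "Q r \<le> E * (X + q * (g - 1)) / (E * g)"
      unfolding Q_def \<Psi>_def E_def[symmetric] g_def[symmetric]
      using \<open>E > 0\<close> \<open>g \<ge> 1\<close> by (intro divide_right_mono) auto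
    also have "\<dots> = q + (X - q) / g"
      using \<open>E > 0\<close> \<open>g \<ge> 1\<close> by (simp add: field_simps)
    finally show ?thesis by (simp add: g_def)
  qed
  have "q \<le> X"
  proof (rule ccontr)
    assume "\<not> q \<le> X"
    have "Q r \<le> q - (q - X) / growth a b s T" if r: "r \<in> {s..T}" for r
    proof -
      have "(q - X) / growth a b s T \<le> (q - X) / growth a b s r"
        using \<open>\<not> q \<le> X\<close> r nonneg growth_mono[of a b s r T] growth_ge_1[of a b s r]
        by (intro divide_left_mono) auto
      then show ?thesis using step[of r] r by (simp add: diff_divide_distrib)
    qed
    then have "q \<le> q - (q - X) / growth a b s T"
      unfolding q_def using \<open>s \<le> T\<close> by (intro cSUP_least) auto
    moreover have "(q - X) / growth a b s T > 0"
      using \<open>\<not> q \<le> X\<close> growth_ge_1[OF nonneg(1,2) \<open>s \<le> T\<close>] by simp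
    ultimately show False by simp
  qed
  then have "(norm (u t) + e) / \<Psi> t \<le> X" using q_ge[OF t] by (simp add: Q_def)
  then show ?thesis
    using \<Psi>_pos[OF t(1)] by (simp add: X_def \<Psi>_def field_simps)
qed

end

subsection \<open>The bounded solution\<close>

locale impulsive_system = linear_impulsive \<theta> p \<omega> A B N lam
  for \<theta> :: "int \<Rightarrow> real" and p \<omega> and A B :: "real^'m^'m" and N lam +
  fixes f :: "real \<Rightarrow> real^'m \<Rightarrow> real^'m" and h :: "real^'m \<Rightarrow> real^'m"
    and g :: "real \<Rightarrow> real^'m" and \<sigma> :: "int \<Rightarrow> real^'m" and Ms Mf Mh Lf Lh :: real
  assumes f_cont: "continuous_on UNIV (\<lambda>(t, x). f t x)"
    and f_per: "f (t + \<omega>) x = f t x"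
    and g_eq: "\<theta> (k * int p) < t \<Longrightarrow> t \<le> \<theta> ((k + 1) * int p) \<Longrightarrow> g t = \<sigma> k"
    and sigma_bound: "norm (\<sigma> k) \<le> Ms"
    and f_bound: "norm (f t x) \<le> Mf" and h_bound: "norm (h x) \<le> Mh"
    and Lf_pos: "Lf > 0" and Lh_pos: "Lh > 0"
    and f_lip: "norm (f t x - f t y) \<le> Lf * norm (x - y)"
    and h_lip: "norm (h x - h y) \<le> Lh * norm (x - y)"
    and stability: "N * Lf + real p / \<omega> * ln (1 + N * Lh) < lam"
begin

abbreviation solution :: "(real \<Rightarrow> real^'m) \<Rightarrow> bool" where
  "solution \<equiv> imp_solution \<theta> (\<lambda>t x. A *v x + f t x + g t) (\<lambda>x. B *v x + h x)"

text \<open>The forcing is a parameter because solutions driven by \<open>g\<close> are compared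
  with solutions driven by its shifts.\<close>

abbreviation solution_from :: "(real \<Rightarrow> real^'m) \<Rightarrow> real \<Rightarrow> (real \<Rightarrow> real^'m) \<Rightarrow> bool" where
  "solution_from g' \<equiv> imp_solution_from \<theta> (\<lambda>t x. A *v x + f t x + g' t) (\<lambda>x. B *v x + h x)"

section \<open>Decay rate and contraction between solutions\<close>

definition \<kappa> :: real where
  "\<kappa> = lam - N * Lf - real p / \<omega> * ln (1 + N * Lh)"

definition C :: real where
  "C = (1 + N * Lh) ^ p"

lemma \<kappa>_pos: "\<kappa> > 0"
  using stability by (simp add: \<kappa>_def)

lemma C_pos: "C > 0"
  using N_pos Lh_pos by (simp add: C_def add_pos_pos)

lemma bounds_nonneg: "Ms \<ge> 0" "Mf \<ge> 0" "Mh \<ge> 0"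
  using sigma_bound[of 0] f_bound[of 0 0] h_bound[of 0] norm_ge_zero order_trans by blast+

text \<open>With \<open>1 + N * Lh = exp l\<close> the impulse count becomes an exponent. Its linear
  bound contributes the rate \<open>p * l / \<omega>\<close> subtracted in \<kappa>, and the
  rounding term of \<open>icount_le\<close> contributes \<open>C\<close>.\<close>

lemma decay:
  assumes "s \<le> t"
  shows "exp (- lam * (t - s)) * growth Lf Lh s t \<le> C * exp (- \<kappa> * (t - s))"
proof -
  define l where "l = ln (1 + N * Lh)"
  have "1 + N * Lh > 1" using N_pos Lh_pos by simp
  then have el: "1 + N * Lh = exp l" and "l \<ge> 0" by (simp_all add: l_def)
  have "(1 + N * Lh) ^ icount \<theta> s t = exp (real (icount \<theta> s t) * l)"
    by (simp add: el exp_of_nat_mult)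
  also have "\<dots> \<le> exp (real p * ((t - s) / \<omega> + 1) * l)"
    using mult_right_mono[OF icount_le[OF assms] \<open>l \<ge> 0\<close>] by simp
  also have "\<dots> = C * exp (real p / \<omega> * l * (t - s))"
    unfolding C_def el exp_of_nat_mult[symmetric] exp_add[symmetric]
    by (simp add: algebra_simps add_divide_distrib diff_divide_distrib)
  finally have "exp (- lam * (t - s)) * growth Lf Lh s t
      \<le> exp (- lam * (t - s)) * (C * exp (real p / \<omega> * l * (t - s)) * exp (N * Lf * (t - s)))"
    unfolding growth_def by (intro mult_left_mono mult_right_mono) auto
  also have "\<dots> = C * exp (- lam * (t - s) + real p / \<omega> * l * (t - s) + N * Lf * (t - s))"
    by (simp only: exp_add mult_ac)
  also have "- lam * (t - s) + real p / \<omega> * l * (t - s) + N * Lf * (t - s) = - \<kappa> * (t - s)"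
    by (simp add: \<kappa>_def l_def algebra_simps)
  finally show ?thesis .
qed

lemma g_eq_gap:
  assumes "\<theta> j < t" "t \<le> \<theta> (j + 1)"
  shows "g t = \<sigma> (j div int p)"
proof (rule g_eq)
  have "j div int p * int p \<le> j" "j + 1 \<le> (j div int p + 1) * int p"
    using p_pos pos_mod_bound[of "int p" j] pos_mod_sign[of "int p" j] div_mult_mod_eq[of j "int p"]
    unfolding distrib_right by linarith+
  then have "\<theta> (j div int p * int p) \<le> \<theta> j" "\<theta> (j + 1) \<le> \<theta> ((j div int p + 1) * int p)"
    by simp_all
  then show "\<theta> (j div int p * int p) < t" "t \<le> \<theta> ((j div int p + 1) * int p)"
    using assms by linarith+
qed

lemma g_bound: "norm (g t) \<le> Ms"
  using g_eq_gap[OF idx(1) idx(2), of t] sigma_bound by simp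

lemma imp_solution_imp_from:
  assumes "imp_solution \<theta> F J x"
  shows "imp_solution_from \<theta> F J s x"
  using assms unfolding imp_solution_def imp_solution_from_def
  by (meson continuous_at_imp_continuous_at_within has_vector_derivative_continuous)

text \<open>Measuring the forcing difference in units of \<open>Lf\<close> lets it join the
  Lipschitz term under the weight \<open>norm (x - y) + e\<close>. At the jumps the summand
  \<open>e\<close> is mere slack.\<close>

lemma difference_perturbed:
  assumes x: "solution_from g1 s x" and y: "solution_from g2 s y" and "e \<ge> 0"
    and g12: "\<And>r. s < r \<Longrightarrow> r \<le> T \<Longrightarrow> norm (g1 r - g2 r) \<le> Lf * e"
  shows "perturbed s T (\<lambda>r. norm (x r - y r) + e) Lf Lh (\<lambda>r. x r - y r)"
  unfolding perturbed_def
proof (intro conjI allI impI)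
  fix r assume r: "s < r \<and> r \<le> T \<and> r \<notin> range \<theta>"
  let ?F = "f r (x r) - f r (y r) + (g1 r - g2 r)"
  have "((\<lambda>r. x r - y r) has_vector_derivative
      (A *v x r + f r (x r) + g1 r) - (A *v y r + f r (y r) + g2 r)) (at r)"
    using x y r unfolding imp_solution_from_def by (intro has_vector_derivative_diff) auto
  also have "(A *v x r + f r (x r) + g1 r) - (A *v y r + f r (y r) + g2 r) = A *v (x r - y r) + ?F"
    by (simp add: matrix_vector_mult_diff_distrib)
  finally have "((\<lambda>r. x r - y r) has_vector_derivative A *v (x r - y r) + ?F) (at r)" .
  moreover have "norm ?F \<le> Lf * (norm (x r - y r) + e)"
    using norm_triangle_ineq[of "f r (x r) - f r (y r)" "g1 r - g2 r"] f_lip[of r "x r" "y r"]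
      g12[of r] r by (simp add: algebra_simps)
  ultimately show "\<exists>F. ((\<lambda>r. x r - y r) has_vector_derivative A *v (x r - y r) + F) (at r) \<and>
      norm F \<le> Lf * (norm (x r - y r) + e)" by blast
next
  fix k assume k: "s \<le> \<theta> k \<and> \<theta> k < T"
  let ?J = "h (x (\<theta> k)) - h (y (\<theta> k))"
  have "((\<lambda>r. x r - y r) \<longlongrightarrow> (x (\<theta> k) + (B *v x (\<theta> k) + h (x (\<theta> k))))
      - (y (\<theta> k) + (B *v y (\<theta> k) + h (y (\<theta> k))))) (at_right (\<theta> k))"
    using x y k unfolding imp_solution_from_def by (intro tendsto_diff) auto
  also have "(x (\<theta> k) + (B *v x (\<theta> k) + h (x (\<theta> k)))) - (y (\<theta> k) + (B *v y (\<theta> k) + h (y (\<theta> k))))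
      = x (\<theta> k) - y (\<theta> k) + B *v (x (\<theta> k) - y (\<theta> k)) + ?J"
    by (simp add: matrix_vector_mult_diff_distrib)
  finally have "((\<lambda>r. x r - y r) \<longlongrightarrow> x (\<theta> k) - y (\<theta> k) + B *v (x (\<theta> k) - y (\<theta> k)) + ?J) (at_right (\<theta> k))" .
  moreover have "norm ?J \<le> Lh * (norm (x (\<theta> k) - y (\<theta> k)) + e)"
    using h_lip[of "x (\<theta> k)" "y (\<theta> k)"] mult_nonneg_nonneg[OF less_imp_le[OF Lh_pos] \<open>e \<ge> 0\<close>]
    by (simp add: algebra_simps)
  ultimately show "\<exists>J. ((\<lambda>r. x r - y r) \<longlongrightarrow> x (\<theta> k) - y (\<theta> k) + B *v (x (\<theta> k) - y (\<theta> k)) + J) (at_right (\<theta> k)) \<and>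
      norm J \<le> Lh * (norm (x (\<theta> k) - y (\<theta> k)) + e)" by blast
qed (use x y in \<open>auto simp: imp_solution_from_def intro: continuous_diff\<close>)

lemma difference_bound:
  assumes x: "solution_from g1 s x" and y: "solution_from g2 s y" and "e \<ge> 0"
    and g12: "\<And>r. s < r \<Longrightarrow> r \<le> T \<Longrightarrow> norm (g1 r - g2 r) \<le> Lf * e"
    and t: "s \<le> t" "t \<le> T"
  shows "norm (x t - y t) \<le> C * exp (- \<kappa> * (t - s)) * (N * norm (x s - y s) + e * exp (lam * (T - s)))"
proof -
  have "norm (x t - y t) + e \<le> exp (- lam * (t - s)) * growth Lf Lh s t *
      (N * norm (x s - y s) + e * exp (lam * (T - s)))"
    using impulsive_gronwall[OF difference_perturbed[OF x y \<open>e \<ge> 0\<close> g12]] Lf_pos Lh_pos \<open>e \<ge> 0\<close> t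
    by simp
  also have "\<dots> \<le> C * exp (- \<kappa> * (t - s)) * (N * norm (x s - y s) + e * exp (lam * (T - s)))"
    using N_pos \<open>e \<ge> 0\<close> by (intro mult_right_mono decay t) auto
  finally show ?thesis using \<open>e \<ge> 0\<close> by simp
qed

lemma solution_contraction:
  assumes "solution_from g1 s x" "solution_from g1 s y" "s \<le> t"
  shows "norm (x t - y t) \<le> C * N * exp (- \<kappa> * (t - s)) * norm (x s - y s)"
  using difference_bound[OF assms(1,2), of 0 t t] assms(3) by (simp add: mult_ac)

text \<open>With this \<open>E0\<close>, the bounded terms \<open>f\<close>, \<open>g\<close>, \<open>h\<close> are a perturbation of the form
  \<open>a (norm u + e)\<close> required by \<open>impulsive_gronwall\<close>, so no separate a priori estimate is needed.\<close>
definition E0 :: real where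
  "E0 = max ((Mf + Ms) / Lf) (Mh / Lh)"

lemma E0_nonneg: "E0 \<ge> 0"
  using bounds_nonneg Lf_pos by (simp add: E0_def le_max_iff_disj)

lemma solution_perturbed:
  assumes x: "solution_from g s x"
  shows "perturbed s T (\<lambda>r. norm (x r) + E0) Lf Lh x"
  unfolding perturbed_def
proof (intro conjI allI impI)
  fix r assume r: "s < r \<and> r \<le> T \<and> r \<notin> range \<theta>"
  have "(x has_vector_derivative A *v x r + (f r (x r) + g r)) (at r)"
    using x r unfolding imp_solution_from_def by (simp add: add.assoc)
  moreover have "norm (f r (x r) + g r) \<le> Lf * (norm (x r) + E0)"
  proof -
    have "norm (f r (x r) + g r) \<le> Mf + Ms"
      using norm_triangle_ineq[of "f r (x r)" "g r"] f_bound[of r "x r"] g_bound[of r] by linarith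
    also have "\<dots> \<le> Lf * E0"
    proof -
      have "(Mf + Ms) / Lf \<le> E0" by (simp add: E0_def)
      then show ?thesis using Lf_pos by (simp add: pos_divide_le_eq mult.commute)
    qed
    also have "\<dots> \<le> Lf * (norm (x r) + E0)" using Lf_pos by simp
    finally show ?thesis .
  qed
  ultimately show "\<exists>F. (x has_vector_derivative A *v x r + F) (at r) \<and> norm F \<le> Lf * (norm (x r) + E0)"
    by blast
next
  fix k assume k: "s \<le> \<theta> k \<and> \<theta> k < T"
  have "(x \<longlongrightarrow> x (\<theta> k) + B *v x (\<theta> k) + h (x (\<theta> k))) (at_right (\<theta> k))"
    using x k unfolding imp_solution_from_def by (simp add: add.assoc)
  moreover have "norm (h (x (\<theta> k))) \<le> Lh * (norm (x (\<theta> k)) + E0)"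
  proof -
    have "Mh / Lh \<le> E0" by (simp add: E0_def)
    then have "norm (h (x (\<theta> k))) \<le> Lh * E0"
      using h_bound[of "x (\<theta> k)"] Lh_pos by (simp add: pos_divide_le_eq mult.commute)
    also have "\<dots> \<le> Lh * (norm (x (\<theta> k)) + E0)" using Lh_pos by simp
    finally show ?thesis .
  qed
  ultimately show "\<exists>J. (x \<longlongrightarrow> x (\<theta> k) + B *v x (\<theta> k) + J) (at_right (\<theta> k)) \<and>
      norm J \<le> Lh * (norm (x (\<theta> k)) + E0)" by blast
qed (use x in \<open>auto simp: imp_solution_from_def\<close>)

text \<open>The factor \<open>exp (lam * (T - s))\<close> of the Gronwall bound grows with the
  window, so the bound is taken over a single period. Longer times are handled by
  contraction.\<close>

lemma solution_bound_one_period: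
  assumes x: "solution_from g s x" and t: "s \<le> t" "t \<le> s + \<omega>"
  shows "norm (x t) \<le> C * (N * norm (x s) + E0 * exp (lam * \<omega>))"
proof -
  have "norm (x t) + E0 \<le> exp (- lam * (t - s)) * growth Lf Lh s t * (N * norm (x s) + E0 * exp (lam * (s + \<omega> - s)))"
    using Lf_pos Lh_pos E0_nonneg t by (intro impulsive_gronwall solution_perturbed[OF x]) auto
  also have "\<dots> \<le> (C * 1) * (N * norm (x s) + E0 * exp (lam * \<omega>))"
  proof -
    have "exp (- \<kappa> * (t - s)) \<le> 1" using \<kappa>_pos t by simp
    then have "C * exp (- \<kappa> * (t - s)) \<le> C * 1" using C_pos by (intro mult_left_mono) auto
    then have "exp (- lam * (t - s)) * growth Lf Lh s t \<le> C * 1" using decay[OF t(1)] by linarith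
    then show ?thesis using N_pos E0_nonneg unfolding add_diff_cancel_left' by (intro mult_right_mono) auto
  qed
  finally show ?thesis using E0_nonneg by simp
qed

section \<open>Solutions on one gap and their gluing at the impulse moments\<close>

lemma flow_exists:
  "\<exists>x. x (\<theta> k) = z \<and> (\<forall>t\<in>{\<theta> k..\<theta> (k + 1)}.
     (x has_vector_derivative A *v x t + f t (x t) + \<sigma> (k div int p)) (at t within {\<theta> k..\<theta> (k + 1)}))"
\<comment> \<open>The right-hand side has to be continuous on the closed gap, but at its left end
  \<open>g\<close> may still have the value of the previous period. The constant
  \<open>\<sigma> (k div int p)\<close> agrees with \<open>g\<close> on the rest of the gap.\<close>
proof (rule picard_global[where L = "mnorm A + Lf"])
  have "continuous_on UNIV (\<lambda>y :: real \<times> (real^'m). A *v snd y + f (fst y) (snd y) + \<sigma> (k div int p))"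
    using f_cont unfolding case_prod_beta
    by (intro continuous_intros
        bounded_linear.continuous_on[OF matrix_vector_mul_bounded_linear]) auto
  then show "continuous_on UNIV (\<lambda>(t, x). A *v x + f t x + \<sigma> (k div int p))"
    by (simp add: case_prod_beta)
  show "norm ((A *v x + f t x + \<sigma> (k div int p)) - (A *v y + f t y + \<sigma> (k div int p)))
      \<le> (mnorm A + Lf) * norm (x - y)" for t x y
  proof -
    have "(A *v x + f t x + \<sigma> (k div int p)) - (A *v y + f t y + \<sigma> (k div int p))
        = A *v (x - y) + (f t x - f t y)"
      by (simp add: matrix_vector_mult_diff_distrib)
    then show ?thesis
      using norm_triangle_ineq[of "A *v (x - y)" "f t x - f t y"] f_lip[of t x y]
        norm_matrix_vector_mult_le[of A "x - y"] by (simp add: algebra_simps)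
  qed
qed (use mnorm_nonneg[of A] Lf_pos in auto)

text \<open>Fixing one choice per index and initial value turns the passage across a gap into a map,
  so that \<open>advance\<close> is a function.\<close>

definition flow :: "int \<Rightarrow> real^'m \<Rightarrow> real \<Rightarrow> real^'m" where
  "flow k z = (SOME x. x (\<theta> k) = z \<and> (\<forall>t\<in>{\<theta> k..\<theta> (k + 1)}.
     (x has_vector_derivative A *v x t + f t (x t) + \<sigma> (k div int p)) (at t within {\<theta> k..\<theta> (k + 1)})))"

lemma flow:
  shows flow_init: "flow k z (\<theta> k) = z"
    and flow_deriv: "t \<in> {\<theta> k..\<theta> (k + 1)} \<Longrightarrow>
      (flow k z has_vector_derivative A *v flow k z t + f t (flow k z t) + \<sigma> (k div int p))
        (at t within {\<theta> k..\<theta> (k + 1)})"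
  using someI_ex[OF flow_exists[of k z]] unfolding flow_def by blast+

lemma flow_tendsto:
  assumes "t \<in> {\<theta> k..\<theta> (k + 1)}"
  shows "(flow k z \<longlongrightarrow> flow k z t) (at t within {\<theta> k..\<theta> (k + 1)})"
  using has_vector_derivative_continuous[OF flow_deriv[OF assms]] by (simp add: continuous_within)

definition after_jump :: "real^'m \<Rightarrow> real^'m" where
  "after_jump z = z + (B *v z + h z)"

definition advance :: "int \<Rightarrow> real^'m \<Rightarrow> real^'m" where
  "advance k z = flow k (after_jump z) (\<theta> (k + 1))"

text \<open>Here \<open>c k\<close> stands for the value at \<theta>_k before the jump. The pieces
  fit together into a solution once \<open>c\<close> follows the recursion given by
  \<open>advance\<close>.\<close>

definition glue :: "(int \<Rightarrow> real^'m) \<Rightarrow> real \<Rightarrow> real^'m" where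
  "glue c t = flow (idx t) (after_jump (c (idx t))) t"

lemma glue_eq_flow: "\<theta> k < t \<Longrightarrow> t \<le> \<theta> (k + 1) \<Longrightarrow> glue c t = flow k (after_jump (c k)) t"
  using idx_eqI[of k t] by (simp add: glue_def)

lemma glue_theta: "glue c (\<theta> (k + 1)) = advance k (c k)"
  by (simp add: glue_eq_flow[of k] advance_def)

lemma glue_has_vector_derivative:
  assumes "t \<notin> range \<theta>"
  shows "(glue c has_vector_derivative A *v glue c t + f t (glue c t) + g t) (at t)"
proof -
  define k where "k = idx t"
  have "t \<noteq> \<theta> (k + 1)" using assms by auto
  then have t: "\<theta> k < t" "t < \<theta> (k + 1)"
    using idx[of t] by (auto simp: k_def less_le)
  then have "at t within {\<theta> k..\<theta> (k + 1)} = at t" by (rule at_within_Icc_at)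
  with flow_deriv[of t k "after_jump (c k)"] t
  have "(flow k (after_jump (c k)) has_vector_derivative A *v glue c t + f t (glue c t) + g t) (at t)"
    by (simp add: glue_eq_flow[of k t] g_eq_gap[of k t])
  then show ?thesis
    by (rule has_vector_derivative_transform_within_open[where S = "{\<theta> k<..<\<theta> (k + 1)}"])
       (use t in \<open>auto simp: glue_eq_flow[of k]\<close>)
qed

lemma glue_tendsto_left: "(glue c \<longlongrightarrow> glue c (\<theta> k)) (at_left (\<theta> k))"
proof -
  have lt: "\<theta> (k - 1) < \<theta> k" by simp
  have "(flow (k - 1) (after_jump (c (k - 1))) \<longlongrightarrow> glue c (\<theta> k)) (at_left (\<theta> k))"
    using flow_tendsto[of "\<theta> k" "k - 1" "after_jump (c (k - 1))"] at_within_Icc_at_left[OF lt]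
    by (simp add: glue_eq_flow[of "k - 1"])
  moreover have "eventually (\<lambda>t. flow (k - 1) (after_jump (c (k - 1))) t = glue c t) (at_left (\<theta> k))"
    using eventually_at_left_real[OF lt] by (rule eventually_mono) (simp add: glue_eq_flow[of "k - 1"])
  ultimately show ?thesis by (rule Lim_transform_eventually)
qed

lemma glue_tendsto_right: "(glue c \<longlongrightarrow> after_jump (c k)) (at_right (\<theta> k))"
proof -
  have lt: "\<theta> k < \<theta> (k + 1)" by simp
  have "(flow k (after_jump (c k)) \<longlongrightarrow> after_jump (c k)) (at_right (\<theta> k))"
    using flow_tendsto[of "\<theta> k" k "after_jump (c k)"] at_within_Icc_at_right[OF lt]
    by (simp add: flow_init)
  moreover have "eventually (\<lambda>t. flow k (after_jump (c k)) t = glue c t) (at_right (\<theta> k))"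
    using eventually_at_right_real[OF lt] by (rule eventually_mono) (simp add: glue_eq_flow[of k])
  ultimately show ?thesis by (rule Lim_transform_eventually)
qed

lemma glue_solution:
  assumes c: "\<And>k. c (k + 1) = advance k (c k)"
  shows "solution (glue c)"
proof -
  have eq: "glue c (\<theta> k) = c k" for k
    using glue_theta[of c "k - 1"] c[of "k - 1"] by simp
  show ?thesis
    unfolding imp_solution_def continuous_within
    using glue_has_vector_derivative glue_tendsto_left[of c] glue_tendsto_right[of c]
    by (simp add: eq after_jump_def)
qed

lemma glue_solution_from:
  assumes c: "\<And>k. k0 \<le> k \<Longrightarrow> c (k + 1) = advance k (c k)"
  shows "\<exists>x. solution_from g (\<theta> k0) x \<and> (\<forall>k\<ge>k0. x (\<theta> k) = c k)"
proof -
  \<comment> \<open>At \<theta>_{k0} the glued function is determined by \<open>c (k0 - 1)\<close>,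
    over which the recursion has no control. It is therefore overridden by \<open>c k0\<close>; the
    constant further left is arbitrary.\<close>
  define x where "x t = (if t \<le> \<theta> k0 then c k0 else glue c t)" for t
  have x_theta: "x (\<theta> k) = c k" if "k0 \<le> k" for k
    using glue_theta[of c "k - 1"] c[of "k - 1"] that by (auto simp: x_def)
  have "solution_from g (\<theta> k0) x"
    unfolding imp_solution_from_def
  proof (intro conjI allI impI)
    fix t assume t: "\<theta> k0 < t \<and> t \<notin> range \<theta>"
    then have "(glue c has_vector_derivative A *v x t + f t (x t) + g t) (at t)"
      using glue_has_vector_derivative[of t c] by (simp add: x_def)
    then show "(x has_vector_derivative A *v x t + f t (x t) + g t) (at t)"
      by (rule has_vector_derivative_transform_within_open[where S = "{\<theta> k0<..}"])
         (use t in \<open>auto simp: x_def\<close>)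
  next
    fix k assume k: "\<theta> k0 < \<theta> k"
    have "eventually (\<lambda>t. glue c t = x t) (at_left (\<theta> k))"
      using eventually_at_left_real[OF k] by (rule eventually_mono) (simp add: x_def)
    then show "continuous (at_left (\<theta> k)) x"
      using Lim_transform_eventually[OF glue_tendsto_left] k by (simp add: continuous_within x_def)
  next
    fix k assume k: "\<theta> k0 \<le> \<theta> k"
    have "eventually (\<lambda>t. glue c t = x t) (at_right (\<theta> k))"
      using eventually_at_right_less[of "\<theta> k"]
      by (rule eventually_mono) (use k in \<open>simp add: x_def del: theta_le_iff\<close>)
    then have "(x \<longlongrightarrow> after_jump (c k)) (at_right (\<theta> k))"
      using Lim_transform_eventually[OF glue_tendsto_right] by blast
    then show "(x \<longlongrightarrow> x (\<theta> k) + (B *v x (\<theta> k) + h (x (\<theta> k)))) (at_right (\<theta> k))"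
      using k x_theta[of k] by (simp add: after_jump_def)
  qed simp
  then show ?thesis using x_theta by blast
qed

section \<open>Discrete orbits at the impulse moments and the bounded orbit\<close>

lemma advance_contraction:
  assumes c: "\<And>k. k0 \<le> k \<Longrightarrow> c (k + 1) = advance k (c k)"
    and d: "\<And>k. k0 \<le> k \<Longrightarrow> d (k + 1) = advance k (d k)" and "k0 \<le> k"
  shows "norm (c k - d k) \<le> C * N * exp (- \<kappa> * (\<theta> k - \<theta> k0)) * norm (c k0 - d k0)"
proof -
  obtain x y where "solution_from g (\<theta> k0) x" "\<forall>k\<ge>k0. x (\<theta> k) = c k"
      "solution_from g (\<theta> k0) y" "\<forall>k\<ge>k0. y (\<theta> k) = d k"
    using glue_solution_from[OF c] glue_solution_from[OF d] by blast
  then show ?thesis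
    using solution_contraction[of g "\<theta> k0" x y "\<theta> k"] \<open>k0 \<le> k\<close> by simp
qed

lemma advance_bound:
  assumes c: "\<And>k. k0 \<le> k \<Longrightarrow> c (k + 1) = advance k (c k)" and "k0 \<le> k" "k \<le> k0 + int p"
  shows "norm (c k) \<le> C * (N * norm (c k0) + E0 * exp (lam * \<omega>))"
proof -
  obtain x where x: "solution_from g (\<theta> k0) x" "\<forall>k\<ge>k0. x (\<theta> k) = c k"
    using glue_solution_from[OF c] by blast
  have "\<theta> k \<le> \<theta> (k0 + int p)" using \<open>k \<le> k0 + int p\<close> by simp
  then have "\<theta> k \<le> \<theta> k0 + \<omega>" by (simp add: theta_per)
  then show ?thesis
    using solution_bound_one_period[OF x(1), of "\<theta> k"] x(2) \<open>k0 \<le> k\<close> by simp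
qed

primrec orbit_from :: "int \<Rightarrow> real^'m \<Rightarrow> nat \<Rightarrow> real^'m" where
  "orbit_from k0 z 0 = z"
| "orbit_from k0 z (Suc j) = advance (k0 + int j) (orbit_from k0 z j)"

text \<open>For \<open>k < k0\<close> the truncation by \<open>nat\<close> returns the default
  \<open>z\<close>; the recursion is stated only from \<open>k0\<close> onwards.\<close>

definition orbit :: "int \<Rightarrow> real^'m \<Rightarrow> int \<Rightarrow> real^'m" where
  "orbit k0 z k = orbit_from k0 z (nat (k - k0))"

lemma orbit_init [simp]: "orbit k0 z k0 = z"
  by (simp add: orbit_def)

lemma orbit_step: "k0 \<le> k \<Longrightarrow> orbit k0 z (k + 1) = advance k (orbit k0 z k)"
proof -
  assume "k0 \<le> k"
  then have "nat (k + 1 - k0) = Suc (nat (k - k0))" by simp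
  with \<open>k0 \<le> k\<close> show ?thesis by (simp add: orbit_def)
qed

text \<open>Contraction over one gap with the decay discarded. The continuity of
  \<open>advance\<close> obtained here carries the recursion over to limits of orbits.\<close>

lemma advance_lipschitz: "norm (advance k y - advance k z) \<le> C * N * norm (y - z)"
proof -
  have "norm (orbit k y (k + 1) - orbit k z (k + 1))
      \<le> C * N * exp (- \<kappa> * (\<theta> (k + 1) - \<theta> k)) * norm (orbit k y k - orbit k z k)"
    by (rule advance_contraction) (auto simp: orbit_step)
  also have "\<dots> \<le> C * N * 1 * norm (orbit k y k - orbit k z k)"
    using C_pos N_pos \<kappa>_pos by (intro mult_right_mono mult_left_mono) auto
  finally show ?thesis using orbit_step[of k k y] orbit_step[of k k z] by simp
qed

text \<open>The orbits started from \<open>0\<close> at the indices \<open>- i p\<close> converge as \<open>i \<rightarrow> \<infinity>\<close>, because two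
  consecutive ones differ by a bounded amount at \<open>- i p\<close> and approach each other afterwards.\<close>
lemma bounded_orbit_exists:
  "\<exists>c D. (\<forall>k. c (k + 1) = advance k (c k)) \<and> (\<forall>k. norm (c k) \<le> D)"
proof -
  define M where "M = C * (E0 * exp (lam * \<omega>))"
  define q where "q = exp (- \<kappa> * \<omega>)"
  \<comment> \<open>\<open>M\<close> bounds an orbit from 0 during its first period, and the second
    summand is the geometric series of the later corrections.\<close>
  define D where "D = M + C * N * M / (1 - q)"
  define pb where "pb i = orbit (- i * int p) 0" for i :: int
  \<comment> \<open>\<open>- m k * int p\<close> is the last multiple of \<open>p\<close> not
    exceeding \<open>k\<close>. The sequence for index \<open>k\<close> begins with the orbit for
    which \<open>k\<close> lies in the first period.\<close>
  define m where "m k = - (k div int p)" for k :: int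
  have q: "0 < q" "q < 1" using \<kappa>_pos omega_pos by (simp_all add: q_def)
  have "M \<ge> 0" unfolding M_def using C_pos E0_nonneg by simp
  have pb_step: "pb i (k + 1) = advance k (pb i k)" if "- i * int p \<le> k" for i k
    unfolding pb_def by (rule orbit_step) (use that in simp)
  have first_period: "norm (pb i k) \<le> M" if "- i * int p \<le> k" "k \<le> - i * int p + int p" for i k
  proof -
    have "norm (pb i k) \<le> C * (N * norm (pb i (- i * int p)) + E0 * exp (lam * \<omega>))"
      using that by (intro advance_bound pb_step) auto
    then show ?thesis by (simp add: pb_def M_def)
  qed
  have diff: "norm (pb (i + 1) k - pb i k) \<le> C * N * exp (- \<kappa> * (\<theta> k - \<theta> (- i * int p))) * M"
    if "- i * int p \<le> k" for i k
  proof -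
    have le: "- (i + 1) * int p \<le> - i * int p" by (simp add: algebra_simps)
    have "norm (pb (i + 1) k - pb i k) \<le> C * N * exp (- \<kappa> * (\<theta> k - \<theta> (- i * int p)))
        * norm (pb (i + 1) (- i * int p) - pb i (- i * int p))"
      using that le by (intro advance_contraction pb_step) auto
    also have "\<dots> \<le> C * N * exp (- \<kappa> * (\<theta> k - \<theta> (- i * int p))) * M"
      using first_period[of "i + 1" "- i * int p"] C_pos N_pos
      by (intro mult_left_mono) (auto simp: pb_def algebra_simps)
    finally show ?thesis .
  qed
  have m: "- m k * int p \<le> k" "k \<le> - m k * int p + int p" for k
    using p_pos pos_mod_bound[of "int p" k] pos_mod_sign[of "int p" k] div_mult_mod_eq[of k "int p"]
    unfolding m_def minus_minus by linarith+
  have later: "- (m k + int l) * int p \<le> k" for k l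
    using m(1)[of k] mult_nonneg_nonneg[of "int l" "int p"]
    unfolding minus_add_distrib distrib_right mult_minus_left by linarith
  \<comment> \<open>Starting one period earlier gives the difference one more period to decay, hence
    one more factor \<open>q = exp (- \<kappa> * \<omega>)\<close>.\<close>
  have geometric: "norm (pb (m k + int (Suc l)) k - pb (m k + int l) k) \<le> C * N * M * q ^ l" for k l
  proof -
    have "\<theta> (- (m k + int l) * int p) = \<theta> (- m k * int p) - real l * \<omega>"
      using theta_shift[of "- m k * int p" "- int l"] by (simp add: algebra_simps)
    moreover have "\<theta> (- m k * int p) \<le> \<theta> k" unfolding theta_le_iff by (rule m)
    ultimately have "real l * \<omega> \<le> \<theta> k - \<theta> (- (m k + int l) * int p)" by simp
    then have "\<kappa> * (real l * \<omega>) \<le> \<kappa> * (\<theta> k - \<theta> (- (m k + int l) * int p))"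
      using \<kappa>_pos by (intro mult_left_mono) auto
    then have "exp (- \<kappa> * (\<theta> k - \<theta> (- (m k + int l) * int p))) \<le> exp (real l * (- \<kappa> * \<omega>))"
      by (simp add: algebra_simps)
    also have "\<dots> = q ^ l" unfolding q_def by (rule exp_of_nat_mult)
    finally have "C * N * exp (- \<kappa> * (\<theta> k - \<theta> (- (m k + int l) * int p))) * M \<le> C * N * q ^ l * M"
      using C_pos N_pos \<open>M \<ge> 0\<close> by (intro mult_right_mono mult_left_mono) auto
    moreover have "m k + int (Suc l) = m k + int l + 1" by simp
    ultimately show ?thesis using diff[OF later[where k = k and l = l]] by (simp only: mult_ac)
  qed
  have bounded: "norm (pb (m k + int l) k) \<le> D" for k l
  proof -
    have "norm (pb (m k + int l) k) \<le> M + (\<Sum>j<l. C * N * M * q ^ j)"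
    proof (induction l)
      case 0
      then show ?case using first_period[OF m(1) m(2), of k] by simp
    next
      case (Suc l)
      then show ?case
        using geometric[of k l] norm_triangle_sub[of "pb (m k + int (Suc l)) k" "pb (m k + int l) k"]
        by simp
    qed
    also have "(\<Sum>j<l. C * N * M * q ^ j) = C * N * M * ((1 - q ^ l) / (1 - q))"
      using q by (simp add: sum_distrib_left[symmetric] sum_gp_strict)
    also have "\<dots> \<le> C * N * M * (1 / (1 - q))"
      using q C_pos N_pos \<open>M \<ge> 0\<close> by (intro mult_left_mono divide_right_mono) auto
    finally show ?thesis by (simp add: D_def)
  qed
  have conv: "convergent (\<lambda>l. pb (m k + int l) k)" for k
  proof -
    have "summable (\<lambda>l. pb (m k + int (Suc l)) k - pb (m k + int l) k)"
      by (rule summable_comparison_test'[OF _ geometric]) (use q in \<open>auto intro!: summable_mult summable_geometric\<close>)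
    then have "convergent (\<lambda>n. \<Sum>l<n. pb (m k + int (Suc l)) k - pb (m k + int l) k)"
      by (simp only: summable_iff_convergent)
    then have "convergent (\<lambda>n. pb (m k + int n) k - pb (m k + int 0) k)"
      by (simp only: sum_lessThan_telescope[of "\<lambda>l. pb (m k + int l) k"])
    then show ?thesis using convergent_diff_const_right_iff by blast
  qed
  define c where "c k = lim (\<lambda>l. pb (m k + int l) k)" for k
  have c_lim: "(\<lambda>l. pb (m k + int l) k) \<longlonglongrightarrow> c k" for k
    using conv[of k] by (simp add: c_def convergent_LIMSEQ_iff)
  have "c (k + 1) = advance k (c k)" for k
  proof (rule LIMSEQ_unique)
    \<comment> \<open>The sequences for \<open>k\<close> and \<open>k + 1\<close> may begin at
      different orbits. Dropping an initial segment of the second aligns them, since its offset is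
      the smaller one.\<close>
    have "m (k + 1) \<le> m k"
      unfolding m_def using p_pos by (simp add: zdiv_mono1)
    then have "(\<lambda>l. pb (m k + int l) (k + 1)) = (\<lambda>l. pb (m (k + 1) + int (l + nat (m k - m (k + 1)))) (k + 1))"
      by (simp add: add.commute)
    then show "(\<lambda>l. pb (m k + int l) (k + 1)) \<longlonglongrightarrow> c (k + 1)"
      using LIMSEQ_ignore_initial_segment[OF c_lim[of "k + 1"], of "nat (m k - m (k + 1))"] by simp
    have "(\<lambda>l. advance k (pb (m k + int l) k)) \<longlonglongrightarrow> advance k (c k)"
    proof (rule LIM_zero_cancel, rule Lim_null_comparison)
      show "\<forall>\<^sub>F l in sequentially. norm (advance k (pb (m k + int l) k) - advance k (c k))
          \<le> C * N * norm (pb (m k + int l) k - c k)"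
        by (intro always_eventually allI advance_lipschitz)
      show "(\<lambda>l. C * N * norm (pb (m k + int l) k - c k)) \<longlonglongrightarrow> 0"
        using c_lim[of k] by (intro tendsto_mult_right_zero tendsto_norm_zero LIM_zero)
    qed
    then show "(\<lambda>l. pb (m k + int l) (k + 1)) \<longlonglongrightarrow> advance k (c k)"
      by (simp only: pb_step[OF later])
  qed
  moreover have "norm (c k) \<le> D" for k
    by (rule Lim_bounded[OF tendsto_norm[OF c_lim[of k]], of 0]) (use bounded in auto)
  ultimately show ?thesis by blast
qed

text \<open>The bounded orbit controls the impulse moments. A gap is no longer than a period, so the
  one-period bound covers the times in between.\<close>

lemma bounded_solution_exists: "\<exists>x. solution x \<and> bounded (range x)"
proof -
  obtain c D where c: "\<And>k. c (k + 1) = advance k (c k)" "\<And>k. norm (c k) \<le> D"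
    using bounded_orbit_exists by metis
  have sol: "solution (glue c)" by (rule glue_solution) (rule c)
  have "norm (glue c t) \<le> C * (N * D + E0 * exp (lam * \<omega>))" for t
  proof -
    define k where "k = idx t"
    have "\<theta> (k + 1) \<le> \<theta> (k + int p)" using p_pos by simp
    then have "t \<le> \<theta> k + \<omega>" using idx(2)[of t] by (simp add: theta_per k_def)
    then have "norm (glue c t) \<le> C * (N * norm (glue c (\<theta> k)) + E0 * exp (lam * \<omega>))"
      using idx(1)[of t]
      by (intro solution_bound_one_period imp_solution_imp_from[OF sol]) (auto simp: k_def)
    also have "norm (glue c (\<theta> k)) \<le> D"
      using glue_theta[of c "k - 1"] c(1)[of "k - 1"] c(2)[of k] by simp
    finally show ?thesis using C_pos N_pos by (simp add: mult_left_mono)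
  qed
  then have "bounded (range (glue c))" unfolding bounded_iff by blast
  with sol show ?thesis by blast
qed

subsection \<open>Uniqueness, stability and unpredictability\<close>

text \<open>At time \<open>t - n\<close> two bounded solutions differ by at most a constant, and
  contraction up to time \<open>t\<close> multiplies this by
  \<open>C * N * exp (- \<kappa> * n)\<close>, which tends to 0.\<close>

lemma bounded_solution_unique:
  assumes x: "solution x" "bounded (range x)" and y: "solution y" "bounded (range y)"
  shows "x = y"
proof
  fix t
  have "bounded (range x \<union> range y)" using x(2) y(2) by simp
  then obtain D where "\<forall>v\<in>range x \<union> range y. norm v \<le> D"
    unfolding bounded_iff by blast
  then have D: "norm (x s - y s) \<le> D + D" for s
    using norm_triangle_ineq4[of "x s" "y s"] by (smt (verit) UnI1 UnI2 rangeI)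
  have "norm (x t - y t) \<le> C * N * exp (- \<kappa> * real n) * (D + D)" for n
  proof -
    have "norm (x t - y t) \<le> C * N * exp (- \<kappa> * (t - (t - real n))) * norm (x (t - real n) - y (t - real n))"
      by (rule solution_contraction[OF imp_solution_imp_from[OF x(1)] imp_solution_imp_from[OF y(1)]]) simp
    also have "\<dots> \<le> C * N * exp (- \<kappa> * (t - (t - real n))) * (D + D)"
      using C_pos N_pos by (intro mult_left_mono D) auto
    finally show ?thesis by simp
  qed
  moreover have "(\<lambda>n. C * N * exp (- \<kappa> * real n) * (D + D)) \<longlonglongrightarrow> 0"
    using \<kappa>_pos by real_asymp
  ultimately have "norm (x t - y t) \<le> 0"
    by (intro LIMSEQ_le_const) auto
  then show "x t = y t" by simp
qed

lemma solution_asym_stable: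
  assumes x: "solution x"
  shows "imp_asym_stable \<theta> (\<lambda>t x. A *v x + f t x + g t) (\<lambda>x. B *v x + h x) x"
proof -
  have est: "norm (y t - x t) \<le> C * N * exp (- \<kappa> * (t - s)) * norm (y s - x s)"
    if "solution_from g s y" "s \<le> t" for y s t
    using solution_contraction[OF that(1) imp_solution_imp_from[OF x] that(2)] .
  show ?thesis
    unfolding imp_asym_stable_def
  proof (intro conjI allI impI)
    fix s \<epsilon> :: real assume "\<epsilon> > 0"
    have "norm (y t - x t) < \<epsilon>"
      if y: "solution_from g s y" "norm (y s - x s) < \<epsilon> / (C * N)" and "s \<le> t" for y t
    proof -
      have "exp (- \<kappa> * (t - s)) \<le> 1" using \<kappa>_pos \<open>s \<le> t\<close> by simp
      then have "C * N * exp (- \<kappa> * (t - s)) * norm (y s - x s) \<le> C * N * 1 * norm (y s - x s)"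
        using C_pos N_pos by (intro mult_right_mono mult_left_mono) auto
      also have "\<dots> < \<epsilon>" using y(2) C_pos N_pos by (simp add: field_simps)
      finally show ?thesis using est[OF y(1) \<open>s \<le> t\<close>] by linarith
    qed
    moreover have "\<epsilon> / (C * N) > 0" using \<open>\<epsilon> > 0\<close> C_pos N_pos by simp
    ultimately show "\<exists>\<delta>>0. \<forall>y. solution_from g s y \<and> norm (y s - x s) < \<delta> \<longrightarrow>
        (\<forall>t\<ge>s. norm (y t - x t) < \<epsilon>)" by blast
  next
    fix s :: real
    have "((\<lambda>t. norm (y t - x t)) \<longlongrightarrow> 0) at_top" if y: "solution_from g s y" for y
    proof (rule tendsto_0_le[where K = 1])
      show "((\<lambda>t. C * N * exp (- \<kappa> * (t - s)) * norm (y s - x s)) \<longlongrightarrow> 0) at_top"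
        using \<kappa>_pos by real_asymp
      show "eventually (\<lambda>t. norm (norm (y t - x t))
          \<le> norm (C * N * exp (- \<kappa> * (t - s)) * norm (y s - x s)) * 1) at_top"
        using eventually_ge_at_top[of s]
        by (rule eventually_mono) (use est[OF y] C_pos N_pos in \<open>simp add: abs_mult\<close>)
    qed
    \<comment> \<open>Contraction holds for arbitrary initial values, so the radius of attraction
      may be any positive number.\<close>
    then show "\<exists>\<delta>0>0. \<forall>y. solution_from g s y \<and> norm (y s - x s) < \<delta>0 \<longrightarrow>
        ((\<lambda>t. norm (y t - x t)) \<longlongrightarrow> 0) at_top"
      by (intro exI[of _ 1]) auto
  qed
qed

section \<open>Shifts by whole periods\<close>

lemma f_shift: "f (t + of_int j * \<omega>) x = f t x"
proof (induction j rule: int_induct[where k = 0])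
  case (step1 i)
  then show ?case using f_per[of "t + of_int i * \<omega>" x] by (simp add: algebra_simps)
next
  case (step2 i)
  then show ?case using f_per[of "t + of_int (i - 1) * \<omega>" x] by (simp add: algebra_simps)
qed simp

lemma g_eq_sigma: "g t = \<sigma> (idx t div int p)"
  by (rule g_eq_gap[OF idx])

lemma g_shift: "g (t + of_int j * \<omega>) = \<sigma> (idx t div int p + j)"
  using p_pos by (simp add: g_eq_sigma idx_shift add.commute)

lemma solution_shift:
  assumes x: "solution x"
  shows "imp_solution \<theta> (\<lambda>t z. A *v z + f t z + g (t + of_int j * \<omega>)) (\<lambda>z. B *v z + h z)
           (\<lambda>t. x (t + of_int j * \<omega>))"
  unfolding imp_solution_def
proof (intro conjI allI impI)
  let ?d = "of_int j * \<omega>"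
  fix t assume "t \<notin> range \<theta>"
  then have "(x has_vector_derivative A *v x (t + ?d) + f t (x (t + ?d)) + g (t + ?d)) (at (t + ?d))"
    using x range_theta_shift[of t j] unfolding imp_solution_def by (metis f_shift)
  moreover have "((\<lambda>t. t + ?d) has_vector_derivative 1) (at t)"
    by (auto intro!: derivative_eq_intros)
  ultimately show "((\<lambda>t. x (t + ?d)) has_vector_derivative
      A *v x (t + ?d) + f t (x (t + ?d)) + g (t + ?d)) (at t)"
    using vector_diff_chain_at[of "\<lambda>t. t + ?d" 1 t x] by (simp add: o_def)
next
  fix k
  let ?d = "of_int j * \<omega>"
  have \<theta>k: "\<theta> k + ?d = \<theta> (k + j * int p)" by (simp add: theta_shift)
  show "continuous (at_left (\<theta> k)) (\<lambda>t. x (t + ?d))"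
    using x filterlim_compose[OF _ filterlim_shift_at_left[of ?d "\<theta> k"], of x]
    unfolding imp_solution_def continuous_within \<theta>k by blast
  show "((\<lambda>t. x (t + ?d)) \<longlongrightarrow> x (\<theta> k + ?d) + (B *v x (\<theta> k + ?d) + h (x (\<theta> k + ?d)))) (at_right (\<theta> k))"
    using x filterlim_compose[OF _ filterlim_shift_at_right[of ?d "\<theta> k"], of x]
    unfolding imp_solution_def \<theta>k by blast
qed

text \<open>The left end \<alpha> stays strictly inside the gap because the value at \<theta>_k is
  the one before the jump. At \<theta>_{k+1} left continuity suffices.\<close>

lemma solution_continuous_on_gap:
  assumes x: "solution x" and "\<theta> k < \<alpha>" "\<beta> \<le> \<theta> (k + 1)"
  shows "continuous_on {\<alpha>..\<beta>} x"
proof (cases "\<alpha> < \<beta>")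
  case True
  show ?thesis
    unfolding continuous_on_eq_continuous_within
  proof
    fix t assume t: "t \<in> {\<alpha>..\<beta>}"
    show "continuous (at t within {\<alpha>..\<beta>}) x"
    proof (cases "t = \<theta> (k + 1)")
      case True
      then have "t = \<beta>" using t assms by auto
      then show ?thesis
        using x at_within_Icc_at_left[OF \<open>\<alpha> < \<beta>\<close>] unfolding imp_solution_def by (metis True)
    next
      case False
      then have "t \<notin> range \<theta>" using t assms by (intro between_notin_range[of k]) auto
      then have "isCont x t"
        using x has_vector_derivative_continuous unfolding imp_solution_def by blast
      then show ?thesis by (rule continuous_at_imp_continuous_at_within)
    qed
  qed
next
  case False
  then have "{\<alpha>..\<beta>} \<subseteq> {\<alpha>}" by auto
  then show ?thesis using continuous_on_subset[OF continuous_on_sing] by blast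
qed

text \<open>For a bounded solution the right-hand side is bounded, by a constant that does not
  depend on the gap. This gives the uniform continuity condition and later the width of the
  intervals of separation.\<close>

lemma solution_lipschitz_on_gap:
  assumes x: "solution x" and D: "\<And>t. norm (x t) \<le> D"
    and s: "s1 \<in> {\<theta> k<..\<theta> (k + 1)}" "s2 \<in> {\<theta> k<..\<theta> (k + 1)}"
  shows "norm (x s1 - x s2) \<le> (mnorm A * D + Mf + Ms) * \<bar>s1 - s2\<bar>"
proof -
  have *: "norm (x t - x s) \<le> (mnorm A * D + Mf + Ms) * t - (mnorm A * D + Mf + Ms) * s"
    if st: "s < t" "\<theta> k < s" "t \<le> \<theta> (k + 1)" for s t
  proof (rule differentiable_bound_general[OF st(1),
        where f' = "\<lambda>r. A *v x r + f r (x r) + g r" and \<phi>' = "\<lambda>_. mnorm A * D + Mf + Ms"])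
    show "continuous_on {s..t} x" by (rule solution_continuous_on_gap[OF x st(2,3)])
    fix r assume r: "s < r" "r < t"
    then have "r \<notin> range \<theta>" using st by (intro between_notin_range[of k]) auto
    then show "(x has_vector_derivative A *v x r + f r (x r) + g r) (at r)"
      using x by (simp add: imp_solution_def)
    have "norm (A *v x r) \<le> mnorm A * D"
      by (rule order_trans[OF norm_matrix_vector_mult_le mult_left_mono[OF D mnorm_nonneg]])
    then show "norm (A *v x r + f r (x r) + g r) \<le> mnorm A * D + Mf + Ms"
      by (intro norm_triangle_mono f_bound g_bound)
    show "((*) (mnorm A * D + Mf + Ms) has_vector_derivative mnorm A * D + Mf + Ms) (at r)"
      by (auto intro!: derivative_eq_intros)
  qed (intro continuous_intros)
  show ?thesis
    using *[of s1 s2] *[of s2 s1] s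
    by (cases s1 s2 rule: linorder_cases) (auto simp: norm_minus_commute algebra_simps abs_if)
qed

lemma shifted_solution_tendsto:
  assumes x: "solution x" and D: "\<And>t. norm (x t) \<le> D"
    and \<zeta>: "\<And>k. (\<lambda>n. \<sigma> (k + int (\<zeta> n))) \<longlonglongrightarrow> \<sigma> k" and "compact K"
  shows "uniform_limit K (\<lambda>n t. x (t + real (\<zeta> n) * \<omega>)) x sequentially"
proof (rule uniform_limitI)
  fix \<epsilon> :: real assume "\<epsilon> > 0"
  obtain R where R: "\<And>t. t \<in> K \<Longrightarrow> \<bar>t\<bar> \<le> R"
    using compact_imp_bounded[OF \<open>compact K\<close>] unfolding bounded_iff by auto
  \<comment> \<open>The starting time \<open>s\<close> is chosen first, so far back that the initial
    difference, at most \<open>D + D\<close>, has decayed below \<epsilon>/2 by time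
    \<open>- R\<close>.\<close>
  have "((\<lambda>s. C * exp (- \<kappa> * (- R - s)) * (N * (D + D))) \<longlongrightarrow> 0) at_bot"
    using \<kappa>_pos by real_asymp
  then have "eventually (\<lambda>s. C * exp (- \<kappa> * (- R - s)) * (N * (D + D)) < \<epsilon> / 2) at_bot"
    using \<open>\<epsilon> > 0\<close> by (intro order_tendstoD(2)) auto
  then obtain s where s: "C * exp (- \<kappa> * (- R - s)) * (N * (D + D)) < \<epsilon> / 2" "s \<le> - R"
    using eventually_conj[OF _ eventually_le_at_bot[of "- R"]] eventually_happens'[of at_bot] by force
  \<comment> \<open>With \<open>s\<close> and \<open>R\<close> fixed, the amplification
    \<open>exp (lam * (R - s))\<close> is a constant, and \<open>e\<close> is scaled so that the
    forcing contributes \<epsilon>/4.\<close>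
  define e where "e = \<epsilon> / (4 * C * exp (lam * (R - s)))"
  have "e > 0" using \<open>\<epsilon> > 0\<close> C_pos by (simp add: e_def)
  \<comment> \<open>Only finitely many periods meet the window, so pointwise convergence of the
    shifted \<sigma> is uniform there.\<close>
  let ?J = "{idx s div int p..idx R div int p}"
  have "eventually (\<lambda>n. \<forall>k\<in>?J. dist (\<sigma> (k + int (\<zeta> n))) (\<sigma> k) < Lf * e) sequentially"
    using \<zeta> Lf_pos \<open>e > 0\<close> by (intro eventually_ball_finite) (auto intro!: tendstoD)
  then show "eventually (\<lambda>n. \<forall>t\<in>K. dist (x (t + real (\<zeta> n) * \<omega>)) (x t) < \<epsilon>) sequentially"
  proof (rule eventually_mono, intro ballI)
    fix n t assume n: "\<forall>k\<in>?J. dist (\<sigma> (k + int (\<zeta> n))) (\<sigma> k) < Lf * e" and "t \<in> K"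
    then have t: "- R \<le> t" "t \<le> R" using R[of t] by auto
    let ?y = "\<lambda>t. x (t + of_int (int (\<zeta> n)) * \<omega>)"
    have "norm (g (r + of_int (int (\<zeta> n)) * \<omega>) - g r) \<le> Lf * e" if "s < r" "r \<le> R" for r
    proof -
      have "idx r div int p \<in> ?J"
        using that p_pos by (auto intro!: zdiv_mono1 idx_mono)
      then show ?thesis
        using n unfolding g_shift g_eq_sigma[of r] dist_norm by (auto intro: less_imp_le)
    qed
    then have "norm (?y t - x t) \<le> C * exp (- \<kappa> * (t - s)) * (N * norm (?y s - x s) + e * exp (lam * (R - s)))"
      using s t \<open>e > 0\<close>
      by (intro difference_bound[OF imp_solution_imp_from[OF solution_shift[OF x]] imp_solution_imp_from[OF x]]) auto
    also have "\<dots> = C * exp (- \<kappa> * (t - s)) * (N * norm (?y s - x s)) + C * exp (- \<kappa> * (t - s)) * (e * exp (lam * (R - s)))"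
      by (rule distrib_left)
    also have "C * exp (- \<kappa> * (t - s)) * (N * norm (?y s - x s)) \<le> C * exp (- \<kappa> * (- R - s)) * (N * (D + D))"
    proof -
      have "norm (?y s - x s) \<le> D + D"
        by (rule order_trans[OF norm_triangle_ineq4 add_mono[OF D D]])
      then show ?thesis
        using C_pos N_pos \<kappa>_pos t by (intro mult_mono) auto
    qed
    also have "C * exp (- \<kappa> * (t - s)) * (e * exp (lam * (R - s))) \<le> C * 1 * (e * exp (lam * (R - s)))"
      using C_pos \<kappa>_pos \<open>e > 0\<close> s t by (intro mult_right_mono mult_left_mono) auto
    also have "\<dots> = \<epsilon> / 4" using C_pos by (simp add: e_def)
    finally show "dist (x (t + real (\<zeta> n) * \<omega>)) (x t) < \<epsilon>"
      using s(1) \<open>\<epsilon> > 0\<close> by (simp add: dist_norm)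
  qed
qed

text \<open>If the difference \<open>v\<close> stayed below \<open>2 * \<epsilon>0\<close>, then its
  derivative would be the constant \<open>c\<close> up to an error of at most \<open>L\<close>. The
  drift \<open>(\<beta> - \<alpha>) * norm c\<close> would then be less than
  \<open>4 * \<epsilon>0 + L * (\<beta> - \<alpha>)\<close>, against the choice of
  \<epsilon>0.\<close>

lemma shifted_solution_separates:
  assumes x: "solution x" and gap: "\<theta> k < \<alpha>" "\<alpha> < \<beta>" "\<beta> \<le> \<theta> (k + 1)"
    and \<delta>0: "\<delta>0 \<le> norm (\<sigma> (k div int p + j) - \<sigma> (k div int p))"
    and \<epsilon>0: "4 * \<epsilon>0 + 2 * (mnorm A + Lf) * \<epsilon>0 * (\<beta> - \<alpha>) \<le> \<delta>0 * (\<beta> - \<alpha>)"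
  shows "\<exists>t\<in>{\<alpha>..\<beta>}. 2 * \<epsilon>0 \<le> norm (x (t + of_int j * \<omega>) - x t)"
proof (rule ccontr)
  define y where "y t = x (t + of_int j * \<omega>)" for t
  define v where "v t = y t - x t" for t
  define c where "c = \<sigma> (k div int p + j) - \<sigma> (k div int p)"
  define L where "L = (mnorm A + Lf) * (2 * \<epsilon>0)"
  assume "\<not> ?thesis"
  then have small: "norm (v t) < 2 * \<epsilon>0" if "\<alpha> \<le> t" "t \<le> \<beta>" for t
    using that by (auto simp: v_def y_def not_le)
  have y: "imp_solution \<theta> (\<lambda>t z. A *v z + f t z + g (t + of_int j * \<omega>)) (\<lambda>z. B *v z + h z) y"
    unfolding y_def by (rule solution_shift[OF x])
  \<comment> \<open>Subtracting \<open>t *\<^sub>R c\<close> removes the constant drift; only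
    Lipschitz-controlled terms are left in the derivative.\<close>
  have "norm ((v \<beta> - \<beta> *\<^sub>R c) - (v \<alpha> - \<alpha> *\<^sub>R c)) \<le> L * \<beta> - L * \<alpha>"
  proof (rule differentiable_bound_general[OF \<open>\<alpha> < \<beta>\<close>,
        where f' = "\<lambda>r. A *v v r + (f r (y r) - f r (x r))" and \<phi>' = "\<lambda>_. L"])
    have "continuous_on {\<alpha>..\<beta>} y"
    proof -
      have "continuous_on {\<alpha> + of_int j * \<omega>..\<beta> + of_int j * \<omega>} x"
        using gap theta_shift[of k j] theta_shift[of "k + 1" j]
        by (intro solution_continuous_on_gap[OF x, of "k + j * int p"]) (auto simp: add_ac)
      then show ?thesis
        unfolding y_def by (rule continuous_on_compose2) (auto intro!: continuous_intros)
    qed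
    then show "continuous_on {\<alpha>..\<beta>} (\<lambda>t. v t - t *\<^sub>R c)"
      unfolding v_def using solution_continuous_on_gap[OF x gap(1,3)] by (intro continuous_intros)
    fix r assume r: "\<alpha> < r" "r < \<beta>"
    have r': "\<theta> k < r" "r < \<theta> (k + 1)" using r gap by auto
    then have "r \<notin> range \<theta>" by (rule between_notin_range)
    moreover have "idx r = k" using r' by (intro idx_eqI) auto
    ultimately have "(x has_vector_derivative A *v x r + f r (x r) + \<sigma> (k div int p)) (at r)"
        "(y has_vector_derivative A *v y r + f r (y r) + \<sigma> (k div int p + j)) (at r)"
      using x y unfolding imp_solution_def by (metis g_eq_sigma, metis g_shift)
    then have "((\<lambda>t. y t - x t - t *\<^sub>R c) has_vector_derivative
        (A *v y r + f r (y r) + \<sigma> (k div int p + j)) - (A *v x r + f r (x r) + \<sigma> (k div int p)) - 1 *\<^sub>R c) (at r)"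
      by (auto intro!: derivative_eq_intros)
    then show "((\<lambda>t. v t - t *\<^sub>R c) has_vector_derivative A *v v r + (f r (y r) - f r (x r))) (at r)"
      by (simp add: v_def c_def matrix_vector_mult_diff_distrib algebra_simps)
    have "norm (A *v v r + (f r (y r) - f r (x r))) \<le> mnorm A * norm (v r) + Lf * norm (v r)"
      unfolding v_def by (intro norm_triangle_mono norm_matrix_vector_mult_le f_lip)
    also have "\<dots> \<le> L"
      unfolding L_def distrib_right using small[of r] r mnorm_nonneg[of A] Lf_pos
      by (intro add_mono mult_left_mono) auto
    finally show "norm (A *v v r + (f r (y r) - f r (x r))) \<le> L" .
    show "((*) L has_vector_derivative L) (at r)"
      by (auto intro!: derivative_eq_intros)
  qed (intro continuous_intros)
  moreover have "(\<beta> - \<alpha>) *\<^sub>R c = (v \<beta> - v \<alpha>) - ((v \<beta> - \<beta> *\<^sub>R c) - (v \<alpha> - \<alpha> *\<^sub>R c))"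
    by (simp add: algebra_simps)
  then have "norm ((\<beta> - \<alpha>) *\<^sub>R c) \<le> norm (v \<beta>) + norm (v \<alpha>) + norm ((v \<beta> - \<beta> *\<^sub>R c) - (v \<alpha> - \<alpha> *\<^sub>R c))"
    by (metis norm_triangle_le_diff norm_triangle_ineq4 add_right_mono)
  moreover have "norm ((\<beta> - \<alpha>) *\<^sub>R c) = (\<beta> - \<alpha>) * norm c"
    using \<open>\<alpha> < \<beta>\<close> by simp
  ultimately have "(\<beta> - \<alpha>) * norm c < 4 * \<epsilon>0 + L * (\<beta> - \<alpha>)"
    using small[of \<alpha>] small[of \<beta>] \<open>\<alpha> < \<beta>\<close> unfolding right_diff_distrib[of L] by linarith
  moreover have "(\<beta> - \<alpha>) * \<delta>0 \<le> (\<beta> - \<alpha>) * norm c"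
    using \<delta>0 \<open>\<alpha> < \<beta>\<close> by (intro mult_left_mono) (auto simp: c_def)
  ultimately show False using \<epsilon>0 by (simp add: L_def algebra_simps)
qed

lemma solution_unpredictable:
  assumes x: "solution x" and "bounded (range x)" and unpred: "unpredictable_seq \<sigma>"
  shows "unpredictable_fun \<theta> x"
proof -
  obtain D where D: "norm (x t) \<le> D" for t
    using \<open>bounded (range x)\<close> unfolding bounded_iff by blast
  have "D \<ge> 0" using D[of 0] norm_ge_zero[of "x 0"] by linarith
  obtain \<delta>0 \<zeta> \<eta> where \<delta>0: "\<delta>0 > 0"
      and \<zeta>: "filterlim \<zeta> at_top sequentially" and \<eta>: "filterlim \<eta> at_top sequentially"
      and lim: "\<And>k. (\<lambda>n. \<sigma> (k + int (\<zeta> n))) \<longlonglongrightarrow> \<sigma> k"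
      and sep: "\<And>n. \<delta>0 \<le> norm (\<sigma> (int (\<zeta> n) + int (\<eta> n)) - \<sigma> (int (\<eta> n)))"
    using unpred unfolding unpredictable_seq_def by blast
  define K where "K = mnorm A * D + Mf + Ms + 1"
  have "K > 0"
    using mnorm_nonneg[of A] \<open>D \<ge> 0\<close> bounds_nonneg by (simp add: K_def add_nonneg_pos)
  have lip: "norm (x s1 - x s2) \<le> K * \<bar>s1 - s2\<bar>"
    if "s1 \<in> {\<theta> k<..\<theta> (k + 1)}" "s2 \<in> {\<theta> k<..\<theta> (k + 1)}" for k s1 s2
    using solution_lipschitz_on_gap[OF x D that] by (simp add: K_def distrib_right add_increasing2)
  \<comment> \<open>Half the length of gap 0. By periodicity every gap whose index is a multiple of
    \<open>p\<close> has length \<open>2 * l\<close>.\<close>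
  define l where "l = (\<theta> 1 - \<theta> 0) / 2"
  have "l > 0" using theta_less_iff[of 0 1] by (simp add: l_def del: theta_less_iff)
  \<comment> \<open>This value turns the inequality required by
    \<open>shifted_solution_separates\<close> into an equality when \<beta> - \<alpha> = l.\<close>
  define \<epsilon>0 where "\<epsilon>0 = \<delta>0 * l / (4 + 2 * (mnorm A + Lf) * l)"
  have denom: "4 + 2 * (mnorm A + Lf) * l > 0"
    using mnorm_nonneg[of A] Lf_pos \<open>l > 0\<close> by (simp add: add_pos_nonneg)
  then have "\<epsilon>0 > 0" using \<delta>0 \<open>l > 0\<close> by (simp add: \<epsilon>0_def)
  \<comment> \<open>Both \<open>x\<close> and its shift have Lipschitz constant \<open>K\<close>, so
    within distance \<open>2 * r\<close> of a point the difference changes by at most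
    \<open>4 * K * r\<close>, hence by at most \<epsilon>0. The bound \<open>l / 4\<close> leaves
    room for the interval inside {\<alpha>..\<beta>}.\<close>
  define r where "r = min (\<epsilon>0 / (4 * K)) (l / 4)"
  have "r > 0" using \<open>\<epsilon>0 > 0\<close> \<open>K > 0\<close> \<open>l > 0\<close> by (simp add: r_def)
  have r_le: "4 * r \<le> l" by (simp add: r_def)
  have "r \<le> \<epsilon>0 / (4 * K)" by (simp add: r_def)
  then have r_eps: "4 * K * r \<le> \<epsilon>0" using \<open>K > 0\<close> by (simp add: field_simps)
  define \<mu> where "\<mu> n = real (\<zeta> n) * \<omega>" for n
  have "\<exists>\<tau>\<ge>\<theta> (int (\<eta> n) * int p). \<forall>t\<in>{\<tau> - r..\<tau> + r}. norm (x (t + \<mu> n) - x t) \<ge> \<epsilon>0" for n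
  proof -
    define k where "k = int (\<eta> n) * int p"
    define \<beta> where "\<beta> = \<theta> (k + 1)"
    \<comment> \<open>The right half of the first gap in period \<eta>_n: it contains no jump in its
      interior and avoids the left end, where the solution is discontinuous from the right.\<close>
    define \<alpha> where "\<alpha> = \<beta> - l"
    define v where "v t = x (t + \<mu> n) - x t" for t
    have k_div: "k div int p = int (\<eta> n)" using p_pos by (simp add: k_def)
    have "\<theta> (k + 1) - \<theta> k = 2 * l"
      using theta_shift[of 1 "int (\<eta> n)"] theta_shift[of 0 "int (\<eta> n)"]
      by (simp add: k_def l_def add.commute)
    then have gap: "\<theta> k < \<alpha>" "\<alpha> < \<beta>" "\<beta> \<le> \<theta> (k + 1)"
      using \<open>l > 0\<close> by (auto simp: \<alpha>_def \<beta>_def)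
    have "\<exists>t\<in>{\<alpha>..\<beta>}. 2 * \<epsilon>0 \<le> norm (x (t + of_int (int (\<zeta> n)) * \<omega>) - x t)"
    proof (rule shifted_solution_separates[OF x gap])
      show "\<delta>0 \<le> norm (\<sigma> (k div int p + int (\<zeta> n)) - \<sigma> (k div int p))"
        using sep[of n] by (simp add: k_div add.commute)
      have "\<epsilon>0 * (4 + 2 * (mnorm A + Lf) * l) = \<delta>0 * l"
        using denom by (simp add: \<epsilon>0_def)
      then show "4 * \<epsilon>0 + 2 * (mnorm A + Lf) * \<epsilon>0 * (\<beta> - \<alpha>) \<le> \<delta>0 * (\<beta> - \<alpha>)"
        by (simp add: \<alpha>_def algebra_simps)
    qed
    then obtain t0 where t0: "\<alpha> \<le> t0" "t0 \<le> \<beta>" "2 * \<epsilon>0 \<le> norm (v t0)"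
      by (auto simp: v_def \<mu>_def)
    have far: "norm (v t) \<ge> \<epsilon>0" if t: "\<alpha> \<le> t" "t \<le> \<beta>" "\<bar>t - t0\<bar> \<le> 2 * r" for t
    proof -
      have in_gap: "t \<in> {\<theta> k<..\<theta> (k + 1)}" "t0 \<in> {\<theta> k<..\<theta> (k + 1)}"
        using t t0 gap by auto
      have shifted: "s + \<mu> n \<in> {\<theta> (k + int (\<zeta> n) * int p)<..\<theta> (k + int (\<zeta> n) * int p + 1)}"
        if "s \<in> {\<theta> k<..\<theta> (k + 1)}" for s
        using that theta_shift[of k "int (\<zeta> n)"] theta_shift[of "k + 1" "int (\<zeta> n)"]
        by (simp add: \<mu>_def add_ac)
      have "norm (v t0 - v t) \<le> norm (x (t0 + \<mu> n) - x (t + \<mu> n)) + norm (x t0 - x t)"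
        using norm_triangle_ineq4[of "x (t0 + \<mu> n) - x (t + \<mu> n)" "x t0 - x t"]
        by (simp add: v_def algebra_simps)
      also have "\<dots> \<le> K * \<bar>t0 - t\<bar> + K * \<bar>t0 - t\<bar>"
        using lip[OF shifted[OF in_gap(2)] shifted[OF in_gap(1)]] lip[OF in_gap(2,1)] by simp
      also have "\<dots> \<le> K * (2 * r) + K * (2 * r)"
        using t(3) \<open>K > 0\<close> by (intro add_mono mult_left_mono) auto
      also have "\<dots> \<le> \<epsilon>0" using r_eps by simp
      finally show ?thesis
        using t0(3) norm_triangle_sub[of "v t0" "v t"] by linarith
    qed
    \<comment> \<open>The point \<open>t0\<close> becomes an end of the middle part of the window of
      radius \<open>r\<close>, on whichever side fits. If the right side leaves {\<alpha>..\<beta>},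
      then \<open>4 * r \<le> l\<close> guarantees room on the left.\<close>
    define \<tau> where "\<tau> = (if t0 + 2 * r \<le> \<beta> then t0 + r else t0 - r)"
    have "\<alpha> \<le> t \<and> t \<le> \<beta> \<and> \<bar>t - t0\<bar> \<le> 2 * r" if "t \<in> {\<tau> - r..\<tau> + r}" for t
      using that t0 r_le \<open>r > 0\<close> by (auto simp: \<tau>_def \<alpha>_def split: if_splits)
    then have "\<forall>t\<in>{\<tau> - r..\<tau> + r}. \<epsilon>0 \<le> norm (v t)" and "\<alpha> \<le> \<tau>"
      using far \<open>r > 0\<close> by auto
    then show ?thesis
      using gap(1) by (intro exI[of _ \<tau>]) (auto simp: v_def k_def)
  qed
  then obtain \<tau> where \<tau>: "\<And>n. \<theta> (int (\<eta> n) * int p) \<le> \<tau> n"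
      "\<And>n t. t \<in> {\<tau> n - r..\<tau> n + r} \<Longrightarrow> norm (x (t + \<mu> n) - x t) \<ge> \<epsilon>0"
    by metis
  have real_lim: "filterlim (\<lambda>n. real (a n) * \<omega>) at_top sequentially"
    if "filterlim a at_top sequentially" for a :: "nat \<Rightarrow> nat"
    using filterlim_tendsto_pos_mult_at_top[OF tendsto_const omega_pos
        filterlim_compose[OF filterlim_real_sequentially that]] by (simp add: mult.commute)
  have "filterlim (\<lambda>n. \<theta> 0 + real (\<eta> n) * \<omega>) at_top sequentially"
    by (intro filterlim_tendsto_add_at_top[OF tendsto_const] real_lim \<eta>)
  moreover have "\<theta> 0 + real (\<eta> n) * \<omega> \<le> \<tau> n" for n
    using \<tau>(1)[of n] theta_shift[of 0 "int (\<eta> n)"] by simp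
  ultimately have \<tau>_lim: "filterlim \<tau> at_top sequentially"
    by (rule filterlim_at_top_mono[OF _ always_eventually[OF allI]])
  have unif: "\<forall>\<epsilon>>0. \<exists>\<delta>>0. \<forall>k s1 s2. s1 \<in> {\<theta> k<..\<theta> (k + 1)} \<and> s2 \<in> {\<theta> k<..\<theta> (k + 1)} \<and>
      \<bar>s1 - s2\<bar> < \<delta> \<longrightarrow> norm (x s1 - x s2) < \<epsilon>"
  proof (intro allI impI)
    fix \<epsilon> :: real assume "\<epsilon> > 0"
    have "norm (x s1 - x s2) < \<epsilon>"
      if "s1 \<in> {\<theta> k<..\<theta> (k + 1)}" "s2 \<in> {\<theta> k<..\<theta> (k + 1)}" "\<bar>s1 - s2\<bar> < \<epsilon> / K" for k s1 s2
      using lip[OF that(1,2)] that(3) \<open>K > 0\<close> by (simp add: field_simps)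
    then show "\<exists>\<delta>>0. \<forall>k s1 s2. s1 \<in> {\<theta> k<..\<theta> (k + 1)} \<and> s2 \<in> {\<theta> k<..\<theta> (k + 1)} \<and>
        \<bar>s1 - s2\<bar> < \<delta> \<longrightarrow> norm (x s1 - x s2) < \<epsilon>"
      using \<open>\<epsilon> > 0\<close> \<open>K > 0\<close> by (intro exI[of _ "\<epsilon> / K"]) auto
  qed
  have "\<exists>\<epsilon>0>0. \<exists>r>0. \<exists>\<mu> \<tau> :: nat \<Rightarrow> real.
        filterlim \<mu> at_top sequentially \<and> filterlim \<tau> at_top sequentially \<and>
        (\<forall>K. compact K \<longrightarrow> uniform_limit K (\<lambda>n t. x (t + \<mu> n)) x sequentially) \<and>
        (\<forall>n. \<forall>t\<in>{\<tau> n - r..\<tau> n + r}. norm (x (t + \<mu> n) - x t) \<ge> \<epsilon>0)"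
  proof (rule exI[of _ \<epsilon>0], rule conjI[OF \<open>\<epsilon>0 > 0\<close>], rule exI[of _ r], rule conjI[OF \<open>r > 0\<close>],
      rule exI[of _ \<mu>], rule exI[of _ \<tau>], intro conjI allI impI ballI)
    show "filterlim \<mu> at_top sequentially" unfolding \<mu>_def by (rule real_lim[OF \<zeta>])
    show "uniform_limit K (\<lambda>n t. x (t + \<mu> n)) x sequentially" if "compact K" for K
      unfolding \<mu>_def by (rule shifted_solution_tendsto[OF x D lim that])
  qed (use \<tau>_lim \<tau>(2) in auto)
  moreover have "isCont x t" if "t \<notin> range \<theta>" for t
    using x that has_vector_derivative_continuous unfolding imp_solution_def by blast
  moreover have "continuous (at_left (\<theta> k)) x" for k
    using x unfolding imp_solution_def by blast
  ultimately show ?thesis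
    unfolding unpredictable_fun_def using unif \<open>bounded (range x)\<close> by blast
qed

end

theorem theorem3p1:
  fixes A B :: "real^'m^'m"
    and f :: "real \<Rightarrow> real^'m \<Rightarrow> real^'m"
    and h :: "real^'m \<Rightarrow> real^'m"
    and g :: "real \<Rightarrow> real^'m"
    and \<sigma> :: "int \<Rightarrow> real^'m"
    and \<theta> :: "int \<Rightarrow> real"
    and p :: nat
    and \<omega> M\<^sub>\<sigma> M\<^sub>f M\<^sub>h L\<^sub>f L\<^sub>h N lam :: real
  assumes omega_pos: "\<omega> > 0"
    and f_cont: "continuous_on UNIV (\<lambda>(t, x). f t x)"
    and h_cont: "continuous_on UNIV h"
    and f_per: "\<forall>t x. f (t + \<omega>) x = f t x"
    and theta_mono: "strict_mono \<theta>"
    and theta_per: "\<forall>k. \<theta> (k + int p) = \<theta> k + \<omega>"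
    and sigma_bd: "M\<^sub>\<sigma> > 0" "\<forall>k. norm (\<sigma> k) \<le> M\<^sub>\<sigma>"
    and g_def: "\<forall>k t. \<theta> (k * int p) < t \<and> t \<le> \<theta> ((k + 1) * int p) \<longrightarrow> g t = \<sigma> k"
    and A1: "A ** B = B ** A" "det (mat 1 + B) \<noteq> 0"
    and A2: "\<exists>L :: complex^'m^'m. mexp L = cmat (mat 1 + B) \<and> cmat A ** L = L ** cmat A \<and>
               (\<forall>c. is_eigenvalue (cmat A + (real p / \<omega>) *\<^sub>R L) c \<longrightarrow> Re c < 0)"
    and A3: "M\<^sub>f > 0" "M\<^sub>h > 0" "\<forall>t x. norm (f t x) \<le> M\<^sub>f" "\<forall>x. norm (h x) \<le> M\<^sub>h"
    and A4: "L\<^sub>f > 0" "L\<^sub>h > 0"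
      "\<forall>t x1 x2. norm (f t x1 - f t x2) \<le> L\<^sub>f * norm (x1 - x2)"
      "\<forall>x1 x2. norm (h x1 - h x2) \<le> L\<^sub>h * norm (x1 - x2)"
    and N_lambda: "N > 0" "lam > 0"
      "\<forall>t s. s \<le> t \<longrightarrow> mnorm (matriciant \<theta> A B t s) \<le> N * exp (- lam * (t - s))"
    and A5: "N * (L\<^sub>f / lam + real p * L\<^sub>h / (1 - exp (- lam * \<omega>))) < 1"
    and A6: "N * L\<^sub>f + real p / \<omega> * ln (1 + N * L\<^sub>h) < lam"
    and A7: "L\<^sub>h * mnorm (matrix_inv (mat 1 + B)) < 1"
    and unpred: "unpredictable_seq \<sigma>"
  shows "\<exists>!x. imp_solution \<theta> (\<lambda>t x. A *v x + f t x + g t) (\<lambda>x. B *v x + h x) x \<and>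
              unpredictable_fun \<theta> x \<and>
              imp_asym_stable \<theta> (\<lambda>t x. A *v x + f t x + g t) (\<lambda>x. B *v x + h x) x"
proof -
  interpret impulsive_system \<theta> p \<omega> A B N lam f h g \<sigma> M\<^sub>\<sigma> M\<^sub>f M\<^sub>h L\<^sub>f L\<^sub>h
    using theta_mono theta_per omega_pos A1(1) N_lambda f_cont f_per g_def sigma_bd A3 A4 A6
    by unfold_locales auto
  obtain x where x: "solution x" "bounded (range x)"
    using bounded_solution_exists by blast
  show ?thesis
  proof (rule ex1I)
    show "solution x \<and> unpredictable_fun \<theta> x \<and>
        imp_asym_stable \<theta> (\<lambda>t x. A *v x + f t x + g t) (\<lambda>x. B *v x + h x) x"
      using x solution_unpredictable[OF x unpred] solution_asym_stable by blast
    fix y assume y: "solution y \<and> unpredictable_fun \<theta> y \<and>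
        imp_asym_stable \<theta> (\<lambda>t x. A *v x + f t x + g t) (\<lambda>x. B *v x + h x) y"
    \<comment> \<open>Boundedness is part of unpredictability, so uniqueness among bounded solutions
      settles the claim.\<close>
    then have "bounded (range y)"
      unfolding unpredictable_fun_def by (elim conjE)
    with y x show "y = x"
      by (intro bounded_solution_unique) simp_all
  qed
qed

end
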